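(* Let $B\in\mathbb{R}_+^{n\times n}$ be an irreducible nonnegative row uniform matrix and let $\eta(B)=\{\rho(A): A\in\mathbb{R}_+^{n\times n},\ \operatorname{Aux}(A)=B\}$. Then: (i) If $\nu(B)<\mu(B)$, then $\eta(B)=(\nu(B),\mu(B))$ (open interval). (ii) If $\nu(B)=\mu(B)$, then $\{\nu(B)\}=\eta(B)=\{\mu(B)\}$.
   Context: $\mathbb{R}_+$ denotes the nonnegative reals; $\rho(A)$ is the spectral radius (Perron root) of a nonnegative matrix $A$. For $A=(a_{ij})\in\mathbb{R}_+^{n\times n}$, the auxiliary matrix $\operatorname{Aux}(A)=(b_{ij})$ is defined by $b_{ij}=\sum_k a_{ik}$ if $a_{ij}\neq0$ and $b_{ij}=0$ if $a_{ij}=0$. A nonnegative matrix is row uniform if, in every row, all nonzero entries are equal. The associated digraph of $B$ has nodes $\{1,\dots,n\}$ and an edge $(i,j)$ of weight $b_{ij}$ exactly when $b_{ij}\neq0$ (loops allowed); $B$ is irreducible if this digraph is strongly connected. $\mu(B)$ and $\nu(B)$ denote respectively the maximum and the minimum, over all cycles $(i_1,\dots,i_\ell)$ of the digraph, of the cycle geometric mean $(b_{i_1i_2}b_{i_2i_3}\cdots b_{i_\ell i_1})^{1/\ell}$ (both are $0$ if there are no cycles). *)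

theory Defs
  imports "Jordan_Normal_Form.Spectral_Radius" "Graph_Theory.Digraph_Component"
begin

(* Rows and columns of an n x n matrix are indexed by 0, ..., n-1 instead of 1, ..., n. *)
definition nonneg_mats :: "nat \<Rightarrow> real mat set" where
  "nonneg_mats n = {A \<in> carrier_mat n n. \<forall>i<n. \<forall>j<n. 0 \<le> A $$ (i, j)}"

definition row_uniform :: "real mat \<Rightarrow> bool" where
  "row_uniform B \<longleftrightarrow>
    (\<forall>i<dim_row B. \<forall>j<dim_col B. \<forall>k<dim_col B.
      B $$ (i, j) \<noteq> 0 \<longrightarrow> B $$ (i, k) \<noteq> 0 \<longrightarrow> B $$ (i, j) = B $$ (i, k))"

definition Aux :: "real mat \<Rightarrow> real mat" where
  "Aux A = mat (dim_row A) (dim_col A)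
    (\<lambda>(i, j). if A $$ (i, j) \<noteq> 0 then \<Sum>k<dim_col A. A $$ (i, k) else 0)"

definition mat_digraph :: "real mat \<Rightarrow> nat pair_pre_digraph" where
  "mat_digraph B = \<lparr>pverts = {..<dim_row B},
    parcs = {(i, j). i < dim_row B \<and> j < dim_col B \<and> B $$ (i, j) \<noteq> 0}\<rparr>"

(* Every vertex reaches itself by the empty walk, so the 1 x 1 zero matrix, whose digraph has
   no cycle, is irreducible; the 0 x 0 matrix is not. *)
definition irreducible_mat :: "real mat \<Rightarrow> bool" where
  "irreducible_mat B \<longleftrightarrow> strongly_connected (with_proj (mat_digraph B))"

definition cycle_mean :: "real mat \<Rightarrow> (nat \<times> nat) list \<Rightarrow> real" where
  "cycle_mean B p = root (length p) (prod_list (map (\<lambda>e. B $$ e) p))"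

(* The cycles are nonempty (loops included) and visit pairwise distinct vertices, so this set
   is finite when B is a square matrix. *)
definition cycle_means :: "real mat \<Rightarrow> real set" where
  "cycle_means B = cycle_mean B ` {p. pre_digraph.cycle (with_proj (mat_digraph B)) p}"

definition mu :: "real mat \<Rightarrow> real" where
  "mu B = (if cycle_means B = {} then 0 else Max (cycle_means B))"

definition nu :: "real mat \<Rightarrow> real" where
  "nu B = (if cycle_means B = {} then 0 else Min (cycle_means B))"

definition rho :: "real mat \<Rightarrow> real" where
  "rho A = spectral_radius (map_mat complex_of_real A)"

definition eta :: "real mat \<Rightarrow> real set" where
  "eta B = {rho A |A. A \<in> nonneg_mats (dim_row B) \<and> Aux A = B}"

end

theory Submission
  imports Defs
begin

text \<open>Matrices \<open>A\<close> with \<open>Aux A = B\<close> are those with the support of \<open>B\<close> whose rows sum to the common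
  nonzero entry of the corresponding row of \<open>B\<close>. If no cycle mean exceeds \<open>\<mu>\<close>, there is a positive
  vector \<open>v\<close> with \<open>b\<^sub>i\<^sub>j v\<^sub>j \<le> \<mu> v\<^sub>i\<close> on all arcs; averaging over each row gives \<open>A v \<le> \<mu> v\<close>, hence
  \<open>\<rho>(A) \<le> \<mu>\<close>, and by irreducibility equality forces \<open>b\<^sub>i\<^sub>j v\<^sub>j = \<mu> v\<^sub>i\<close> on all arcs, so that all cycle
  means are \<open>\<mu>\<close>. The lower bound is dual. Conversely, for \<open>r\<close> strictly between \<open>\<nu>\<close> and \<open>\<mu>\<close>, letting
  almost all the weight of each row follow an arc leading to a cycle of mean \<open>\<nu>\<close> (respectively
  \<open>\<mu>\<close>) gives a spectral radius below (respectively above) \<open>r\<close>, and the value \<open>r\<close> is attained on a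
  path connecting the two.\<close>

section \<open>Potentials on weighted digraphs\<close>

lemma (in wf_digraph) awalk_enters:
  assumes "awalk u p w" "u \<notin> X" "w \<in> X"
  shows "\<exists>e\<in>set p. tail G e \<notin> X \<and> head G e \<in> X"
  using assms
proof (induction p arbitrary: u)
  case Nil
  then show ?case by (auto simp: awalk_Nil_iff)
next
  case (Cons e p)
  then show ?case by (cases "head G e \<in> X") (auto simp: awalk_Cons_iff)
qed

text \<open>While \<open>X\<close> is not everything, a walk from a missing vertex into
  \<open>X\<close> crosses an arc entering \<open>X\<close>, whose tail can be added. This suits
  properties that a vertex obtains from one of its successors.\<close>

lemma (in fin_digraph) strongly_connected_grow_induct [consumes 1, case_names subset nonempty base step]:
  assumes "strongly_connected G" and "X \<subseteq> verts G" and "X \<noteq> {}" and "P X"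
    and step: "\<And>X e. X \<subseteq> verts G \<Longrightarrow> P X \<Longrightarrow> e \<in> arcs G \<Longrightarrow> tail G e \<notin> X \<Longrightarrow> head G e \<in> X
      \<Longrightarrow> P (insert (tail G e) X)"
  shows "P (verts G)"
  using assms(2-4)
proof (induction "card (verts G - X)" arbitrary: X rule: less_induct)
  case less
  show ?case
  proof (cases "X = verts G")
    case False
    then obtain u w where uw: "u \<in> verts G" "u \<notin> X" "w \<in> verts G" "w \<in> X"
      using less.prems by blast
    then obtain p where p: "awalk u p w"
      using assms(1) by (auto simp: strongly_connected_def reachable_awalk)
    obtain e where e: "e \<in> set p" "tail G e \<notin> X" "head G e \<in> X"
      using awalk_enters[OF p] uw by blast
    have eG: "e \<in> arcs G" using e p by auto
    then have t: "tail G e \<in> verts G" by simp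
    have "P (insert (tail G e) X)"
      using step[OF less.prems(1,3) eG e(2,3)] .
    moreover have "card (verts G - insert (tail G e) X) < card (verts G - X)"
      by (rule psubset_card_mono) (use t e in auto)
    ultimately show ?thesis
      using less.hyps less.prems t by blast
  qed (use less in simp)
qed

text \<open>The potential cancels along the walk. On a closed walk the two end values coincide, so
  rescaling the arcs by a potential leaves the weight of a cycle unchanged.\<close>

lemma (in wf_digraph) awalk_telescope:
  fixes c :: "'b \<Rightarrow> real" and v :: "'a \<Rightarrow> real"
  assumes "awalk u p w" and "\<And>x. x \<in> verts G \<Longrightarrow> v x \<noteq> 0"
  shows "prod_list (map (\<lambda>e. c e * v (head G e) / v (tail G e)) p) = prod_list (map c p) * v w / v u"
  using assms(1)
proof (induction p arbitrary: u)
  case (Cons e p)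
  then have e: "e \<in> arcs G" "u = tail G e" "awalk (head G e) p w"
    by (auto simp: awalk_Cons_iff)
  then show ?case
    using Cons.IH[OF e(3)] assms(2)[of "head G e"] by simp
qed (use assms(2) in \<open>auto simp: awalk_Nil_iff\<close>)

text \<open>The other factors multiply to at most 1, so a factor below 1 could not be
  compensated.\<close>

lemma prod_list_eq_1_imp:
  fixes d :: "'b \<Rightarrow> real"
  assumes "\<And>e. e \<in> set p \<Longrightarrow> 0 < d e \<and> d e \<le> 1" and "prod_list (map d p) = 1" and "e \<in> set p"
  shows "d e = 1"
proof -
  have le: "0 \<le> prod_list (map d q) \<and> prod_list (map d q) \<le> 1" if "set q \<subseteq> set p" for q
    using that
  proof (induction q)
    case (Cons x q)
    have "0 < d x" "d x \<le> 1" using assms(1)[of x] Cons.prems by auto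
    then show ?case using Cons by (auto intro: mult_le_one)
  qed simp
  obtain q r where p: "p = q @ e # r" using assms(3) by (meson split_list)
  have "1 = d e * (prod_list (map d q) * prod_list (map d r))"
    using assms(2) unfolding p by (simp add: mult_ac)
  also have "\<dots> \<le> d e * 1"
    using le[of q] le[of r] assms(1)[OF assms(3)] p by (intro mult_left_mono mult_le_one) auto
  finally show ?thesis using assms(1)[OF assms(3)] by simp
qed

text \<open>The potential of a vertex is the maximal weight of a path starting there; putting an arc in
  front of such a path gives either a path or a cycle followed by a path.\<close>

lemma (in fin_digraph) cycle_potential:
  fixes c :: "'b \<Rightarrow> real"
  assumes pos: "\<And>e. e \<in> arcs G \<Longrightarrow> 0 < c e"
    and cyc: "\<And>p. cycle p \<Longrightarrow> prod_list (map c p) \<le> 1"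
  obtains v where "\<And>u. u \<in> verts G \<Longrightarrow> 0 < v u"
    and "\<And>e. e \<in> arcs G \<Longrightarrow> c e * v (head G e) \<le> v (tail G e)"
proof -
  \<comment> \<open>Paths visit distinct vertices, so each \<open>W u\<close> is finite and has a
    maximum; the empty path contributes 1.\<close>
  define W where "W u = (\<lambda>p. prod_list (map c p)) ` {p. \<exists>w. apath u p w}" for u
  have fin: "finite (W u)" for u
  proof -
    have "{p. \<exists>w. apath u p w} \<subseteq> (\<lambda>(u, p, w). p) ` {(u, p, w). apath u p w}" by force
    then show ?thesis unfolding W_def
      using apaths_finite_triple finite_surj by blast
  qed
  have W1: "1 \<in> W u" if "u \<in> verts G" for u
    unfolding W_def using that by (auto simp: apath_Nil_iff intro!: image_eqI[of _ _ "[]"])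
  have prodpos: "0 < prod_list (map c p)" if "set p \<subseteq> arcs G" for p
    using that pos by (induction p) auto
  define v where "v u = Max (W u)" for u
  have vI: "prod_list (map c p) \<le> v u" if "apath u p w" for u p w
    unfolding v_def using fin that by (intro Max_ge) (auto simp: W_def)
  have v1: "1 \<le> v u" if "u \<in> verts G" for u
    unfolding v_def using fin W1[OF that] by (intro Max_ge)
  show thesis
  proof
    show "0 < v u" if "u \<in> verts G" for u
      using v1[OF that] by simp
  next
    fix e assume e: "e \<in> arcs G"
    have "v (head G e) \<in> W (head G e)"
      unfolding v_def using fin W1[of "head G e"] e by (intro Max_in) auto
    then obtain p w where p: "apath (head G e) p w" and vp: "v (head G e) = prod_list (map c p)"
      by (auto simp: W_def)
    show "c e * v (head G e) \<le> v (tail G e)"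
    proof (cases "tail G e \<in> set (awalk_verts (head G e) p)")
      case False
      then have "apath (tail G e) (e # p) w"
        using e p by (simp add: apath_Cons_iff)
      from vI[OF this] show ?thesis by (simp add: vp)
    next
      case True
      obtain q r where qr: "p = q @ r" "awalk (head G e) q (tail G e)" "awalk (tail G e) r w"
        using awalk_decomp[OF _ True, of w] p by (auto simp: apath_def)
      have ap: "apath (head G e) q (tail G e)" "apath (tail G e) r w"
        using p qr by (auto simp: apath_append_iff)
      \<comment> \<open>Dropping the base point from the vertex list of \<open>e # q\<close> leaves
        the vertices of the path \<open>q\<close>, which are distinct.\<close>
      have "cycle (e # q)"
        unfolding cycle_def using ap(1) e
        by (intro exI[of _ "tail G e"]) (auto simp: awalk_Cons_iff apath_def)
      from cyc[OF this] have "c e * prod_list (map c q) \<le> 1" by simp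
      moreover have "0 \<le> prod_list (map c r)"
        using prodpos[of r] qr(3) by (auto simp: less_imp_le)
      ultimately have "c e * prod_list (map c q) * prod_list (map c r) \<le> 1 * prod_list (map c r)"
        by (rule mult_right_mono)
      also have "\<dots> \<le> v (tail G e)" using vI[OF ap(2)] by simp
      finally show ?thesis by (simp add: vp qr(1) mult_ac)
    qed
  qed
qed

text \<open>Makes the vertex set of a critical cycle a valid start for the growth argument:
  following the cycle never leaves it.\<close>

lemma (in wf_digraph) cycle_closed:
  assumes "cycle p" and "e \<in> set p"
  shows "head G e \<in> tail G ` set p"
proof -
  obtain u where u: "awalk u p u" "p \<noteq> []" using assms(1) by (auto simp: cycle_def)
  then have "tail G (hd p) = u" by (cases p) (auto simp: awalk_Cons_iff)
  then have "u \<in> tail G ` set p" using u(2) by force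
  have cas: "cas u p u" using u(1) by auto
  have "head G e \<in> set (awalk_verts u p)"
    using assms(2) u(2) awalk_verts_conv'[OF cas] by auto
  also have "\<dots> = insert (head G (last p)) (tail G ` set p)"
    using u(2) awalk_verts_conv[of u p] by auto
  also have "head G (last p) = u"
    using awlast_of_awalk[OF u(1)] u(2) awalk_verts_conv[of u p] by simp
  finally show ?thesis using \<open>u \<in> tail G ` set p\<close> by auto
qed

text \<open>On a critical cycle any potential satisfies the required inequality; the remaining vertices
  are added one at a time along arcs that enter the set already treated, with small values.\<close>

lemma (in fin_digraph) critical_cycle_growth:
  fixes c :: "'b \<Rightarrow> real"
  assumes sc: "strongly_connected G"
    and pos: "\<And>e. e \<in> arcs G \<Longrightarrow> 0 < c e"
    and cyc: "\<And>p. cycle p \<Longrightarrow> prod_list (map c p) \<le> 1"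
    and crit: "cycle p" "prod_list (map c p) = 1"
    and s: "0 < s" "s < 1"
  obtains v where "\<And>u. u \<in> verts G \<Longrightarrow> 0 < v u"
    and "\<And>u. u \<in> verts G \<Longrightarrow> \<exists>e\<in>arcs G. tail G e = u \<and> s * v u < c e * v (head G e)"
proof -
  \<comment> \<open>Witness arcs have to stay within \<open>X\<close>: redefining \<open>v\<close>
    at a new vertex outside \<open>X\<close> then leaves them intact.\<close>
  define P where "P X \<longleftrightarrow> (\<exists>v. (\<forall>u\<in>verts G. 0 < v u) \<and>
    (\<forall>u\<in>X. \<exists>e\<in>arcs G. tail G e = u \<and> head G e \<in> X \<and> s * v u < c e * v (head G e)))" for X
  obtain v where v: "\<And>u. u \<in> verts G \<Longrightarrow> 0 < v u"
      "\<And>e. e \<in> arcs G \<Longrightarrow> c e * v (head G e) \<le> v (tail G e)"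
    using cycle_potential[OF pos cyc] by blast
  obtain u where u: "awalk u p u" "p \<noteq> []"
    using crit(1) by (auto simp: cycle_def)
  have arcs_p: "set p \<subseteq> arcs G" using u by auto
  \<comment> \<open>Weights rescaled by the potential: at most 1 on each arc, with product 1 around
    the critical cycle, hence all equal to 1 there.\<close>
  define d where "d e = c e * v (head G e) / v (tail G e)" for e
  have dp: "prod_list (map d p) = 1"
    unfolding d_def using awalk_telescope[OF u(1), of v c] v(1) crit(2) u(1)
    by (auto simp: less_imp_neq[THEN not_sym])
  have d: "0 < d e \<and> d e \<le> 1" if "e \<in> set p" for e
  proof -
    have "e \<in> arcs G" using that arcs_p by auto
    then show ?thesis unfolding d_def using v pos by (simp add: divide_le_eq)
  qed
  have eq: "c e * v (head G e) = v (tail G e)" if "e \<in> set p" for e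
  proof -
    have "d e = 1" using prod_list_eq_1_imp[OF d dp that] .
    moreover have "v (tail G e) > 0" using that arcs_p by (auto intro!: v(1))
    ultimately show ?thesis by (simp add: d_def)
  qed
  from sc have "P (verts G)"
  proof (induction rule: strongly_connected_grow_induct[where X = "tail G ` set p" and P = P])
    case subset
    show ?case using arcs_p by auto
  next
    case nonempty
    show ?case using u(2) by simp
  next
    case base
    have "s * v (tail G e) < c e * v (head G e)" if "e \<in> set p" for e
    proof -
      have "v (tail G e) > 0" using that arcs_p by (auto intro!: v(1))
      then show ?thesis using eq[OF that] s by simp
    qed
    then show ?case unfolding P_def
      using v(1) cycle_closed[OF crit(1)] arcs_p by (intro exI[of _ v]) blast
  next
    case (step X a)
    obtain v where v: "\<forall>u\<in>verts G. 0 < v u"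
        "\<forall>u\<in>X. \<exists>e\<in>arcs G. tail G e = u \<and> head G e \<in> X \<and> s * v u < c e * v (head G e)"
      using \<open>P X\<close> unfolding P_def by blast
    \<comment> \<open>Half of the supremum of the admissible values at the new vertex, so that the
      inequality along \<open>a\<close> is strict.\<close>
    define x where "x = c a * v (head G a) / (2 * s)"
    define v' where "v' = v(tail G a := x)"
    have ca: "0 < c a * v (head G a)" using pos v(1) \<open>a \<in> arcs G\<close> by simp
    have x: "0 < x" "s * x < c a * v (head G a)"
      unfolding x_def using ca s by auto
    have v'X: "v' u = v u" if "u \<in> X" for u
      using that \<open>tail G a \<notin> X\<close> by (auto simp: v'_def)
    have "\<exists>e\<in>arcs G. tail G e = u \<and> head G e \<in> insert (tail G a) X
        \<and> s * v' u < c e * v' (head G e)" if "u \<in> insert (tail G a) X" for u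
    proof (cases "u = tail G a")
      case True
      then show ?thesis
        using \<open>a \<in> arcs G\<close> \<open>head G a \<in> X\<close> x(2) v'X[of "head G a"] by (intro bexI[of _ a]) (auto simp: v'_def)
    next
      case False
      then have "u \<in> X" using that by simp
      then obtain e where "e \<in> arcs G" "tail G e = u" "head G e \<in> X" "s * v u < c e * v (head G e)"
        using v(2) by blast
      then show ?thesis using v'X \<open>u \<in> X\<close> by auto
    qed
    moreover have "\<forall>u\<in>verts G. 0 < v' u" using v(1) x(1) by (simp add: v'_def)
    ultimately show ?case unfolding P_def by blast
  qed
  then show thesis using that unfolding P_def by blast
qed

section \<open>The Perron root of a nonnegative matrix\<close>

text \<open>Vectors are functions on indices, so that pointwise inequalities, sign changes and
  updates of one coordinate need no carrier conditions.\<close>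

definition mat_app :: "real mat \<Rightarrow> (nat \<Rightarrow> real) \<Rightarrow> nat \<Rightarrow> real" where
  "mat_app A v i = (\<Sum>j<dim_col A. A $$ (i, j) * v j)"

lemma nonneg_matsD:
  assumes "A \<in> nonneg_mats n"
  shows "A \<in> carrier_mat n n" "dim_row A = n" "dim_col A = n"
    and "\<And>i j. i < n \<Longrightarrow> j < n \<Longrightarrow> 0 \<le> A $$ (i, j)"
  using assms by (auto simp: nonneg_mats_def)

lemma mat_app_mono:
  assumes "A \<in> nonneg_mats n" and "\<And>j. j < n \<Longrightarrow> u j \<le> v j" and "i < n"
  shows "mat_app A u i \<le> mat_app A v i"
  unfolding mat_app_def using nonneg_matsD[OF assms(1)] assms(2,3)
  by (auto intro!: sum_mono mult_left_mono)

lemma mat_app_scale: "mat_app A (\<lambda>j. k * v j) i = k * mat_app A v i"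
  by (simp add: mat_app_def sum_distrib_left mult_ac)

lemma mat_app_uminus: "mat_app A (\<lambda>j. - v j) i = - mat_app A v i"
  by (simp add: mat_app_def sum_negf)

lemma mat_app_add_at:
  assumes "k < dim_col A"
  shows "mat_app A (v(k := v k + d)) i = mat_app A v i + A $$ (i, k) * d"
proof -
  have "A $$ (i, j) * (v(k := v k + d)) j = A $$ (i, j) * v j + (if j = k then A $$ (i, k) * d else 0)" for j
    by (auto simp: algebra_simps)
  then show ?thesis
    using assms by (simp add: mat_app_def sum.distrib)
qed

lemma mat_app_mult:
  assumes "A \<in> carrier_mat n n" "B \<in> carrier_mat n n" "i < n"
  shows "mat_app (A * B) v i = mat_app A (mat_app B v) i"
proof -
  have "mat_app (A * B) v i = (\<Sum>j<n. (\<Sum>k<n. A $$ (i, k) * B $$ (k, j)) * v j)"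
    unfolding mat_app_def using assms
    by (auto intro!: sum.cong simp: scalar_prod_def atLeast0LessThan)
  also have "\<dots> = (\<Sum>k<n. \<Sum>j<n. A $$ (i, k) * (B $$ (k, j) * v j))"
    unfolding sum_distrib_right by (subst sum.swap) (simp add: mult_ac)
  also have "\<dots> = mat_app A (mat_app B v) i"
    using assms by (simp add: mat_app_def sum_distrib_left)
  finally show ?thesis .
qed

text \<open>Take \<open>i\<close> maximizing \<open>x i / v i\<close>.\<close>

lemma mat_app_ratio_max:
  assumes A: "A \<in> nonneg_mats n"
    and v: "\<And>i. i < n \<Longrightarrow> 0 < v i"
    and x: "\<And>i. i < n \<Longrightarrow> 0 \<le> x i" "i0 < n" "x i0 \<noteq> 0"
  obtains i k where "i < n" "0 < k" "x i = k * v i" "mat_app A x i \<le> k * mat_app A v i"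
proof -
  define k where "k = Max ((\<lambda>i. x i / v i) ` {..<n})"
  have "k \<in> (\<lambda>i. x i / v i) ` {..<n}"
    unfolding k_def using x(2) by (intro Max_in) auto
  then obtain i where i: "i < n" "k = x i / v i" by auto
  have k: "x j / v j \<le> k" if "j < n" for j
    unfolding k_def using that by (intro Max_ge) auto
  have "0 < x i0 / v i0" using x v[of i0] by (simp add: order_less_le)
  then have "0 < k" using k[OF x(2)] by simp
  moreover have "x i = k * v i" using i v[of i] by simp
  moreover have "x j \<le> k * v j" if "j < n" for j
    using k[OF that] v[OF that] by (simp add: divide_le_eq)
  then have "mat_app A x i \<le> k * mat_app A v i"
    using mat_app_mono[OF A _ i(1), of x "\<lambda>j. k * v j"] by (simp add: mat_app_scale)
  ultimately show thesis using i(1) that by blast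
qed

section \<open>The digraph of a matrix and irreducibility\<close>

lemma fin_digraph_mat_digraph:
  assumes "A \<in> carrier_mat n n"
  shows "fin_digraph (with_proj (mat_digraph A))"
proof
  show "finite (arcs (with_proj (mat_digraph A)))"
    by (rule finite_subset[of _ "{..<n} \<times> {..<n}"])
      (use assms in \<open>auto simp: mat_digraph_def\<close>)
qed (use assms in \<open>auto simp: mat_digraph_def\<close>)

lemma irreducible_mat_dim_pos:
  assumes "irreducible_mat A" and "A \<in> carrier_mat n n"
  shows "0 < n"
  using assms by (auto simp: irreducible_mat_def strongly_connected_def mat_digraph_def)

lemma irreducible_mat_grow_induct [consumes 2, case_names subset nonempty base step]:
  assumes "irreducible_mat A" and A: "A \<in> carrier_mat n n"
    and "X \<subseteq> {..<n}" and "X \<noteq> {}" and "P X"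
    and step: "\<And>X i j. X \<subseteq> {..<n} \<Longrightarrow> P X \<Longrightarrow> i < n \<Longrightarrow> j < n \<Longrightarrow> A $$ (i, j) \<noteq> 0 \<Longrightarrow> i \<notin> X \<Longrightarrow> j \<in> X
      \<Longrightarrow> P (insert i X)"
  shows "P {..<n}"
proof -
  interpret fin_digraph "with_proj (mat_digraph A)"
    using fin_digraph_mat_digraph[OF A] .
  have "P (verts (with_proj (mat_digraph A)))"
    using assms(1)[unfolded irreducible_mat_def]
  proof (rule strongly_connected_grow_induct[where X = X])
    fix X e
    assume "X \<subseteq> verts (with_proj (mat_digraph A))" "P X" "e \<in> arcs (with_proj (mat_digraph A))"
      "tail (with_proj (mat_digraph A)) e \<notin> X" "head (with_proj (mat_digraph A)) e \<in> X"
    then show "P (insert (tail (with_proj (mat_digraph A)) e) X)"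
      using step[of X "fst e" "snd e"] A by (auto simp: mat_digraph_def)
  qed (use assms(3-5) A in \<open>auto simp: mat_digraph_def\<close>)
  then show ?thesis using A by (simp add: mat_digraph_def)
qed

text \<open>Raising \<open>z\<close> slightly at a row where the inequality is strict makes it strict at every row
  with an arc into that row.\<close>

lemma irreducible_mat_strict_everywhere:
  assumes A: "A \<in> nonneg_mats n" and irr: "irreducible_mat A"
    and le: "\<And>i. i < n \<Longrightarrow> m * z i \<le> mat_app A z i"
    and strict: "i0 < n" "m * z i0 < mat_app A z i0"
    and "0 < d"
  obtains y where "\<And>i. i < n \<Longrightarrow> z i \<le> y i" and "\<And>i. i < n \<Longrightarrow> y i < z i + d"
    and "\<And>i. i < n \<Longrightarrow> m * y i < mat_app A y i"
proof -
  note An = nonneg_matsD[OF A]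
  define P where "P X \<longleftrightarrow> (\<exists>y. (\<forall>i<n. z i \<le> y i \<and> y i < z i + d \<and> m * y i \<le> mat_app A y i) \<and>
    (\<forall>i\<in>X. m * y i < mat_app A y i))" for X
  from irr An(1) have "P {..<n}"
  proof (induction rule: irreducible_mat_grow_induct[where X = "{i0}" and P = P])
    case base
    show ?case unfolding P_def using assms by (intro exI[of _ z]) auto
  next
    \<comment> \<open>The new row is \<open>j\<close>; the row \<open>i\<close> in \<open>X\<close>
      is already strict, and \<open>y\<close> is raised there.\<close>
    case (step X j i)
    then obtain y where y: "\<And>i. i < n \<Longrightarrow> z i \<le> y i \<and> y i < z i + d \<and> m * y i \<le> mat_app A y i"
        "\<And>i. i \<in> X \<Longrightarrow> m * y i < mat_app A y i"
      unfolding P_def by blast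
    \<comment> \<open>The first bound keeps \<open>y\<close> below \<open>z + d\<close>, the second
      spends at most half of the gap in row \<open>i\<close>; \<open>\<bar>m\<bar> + 1\<close> is
      positive whatever \<open>m\<close> is.\<close>
    define e where "e = min ((z i + d - y i) / 2) ((mat_app A y i - m * y i) / (2 * (\<bar>m\<bar> + 1)))"
    have gap: "0 < mat_app A y i - m * y i" using y(2) \<open>i \<in> X\<close> by simp
    have yi: "z i \<le> y i \<and> y i < z i + d" using y(1)[of i] \<open>i < n\<close> by blast
    have e0: "0 < e" unfolding e_def using gap yi by auto
    have "e \<le> (z i + d - y i) / 2" unfolding e_def by (rule min.cobounded1)
    then have ed: "y i + e < z i + d" using yi by argo
    have "m * e \<le> (\<bar>m\<bar> + 1) * e" using e0 by (intro mult_right_mono) auto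
    also have "\<dots> \<le> (\<bar>m\<bar> + 1) * ((mat_app A y i - m * y i) / (2 * (\<bar>m\<bar> + 1)))"
      unfolding e_def by (intro mult_left_mono min.cobounded2) auto
    also have "\<dots> = (mat_app A y i - m * y i) / 2" by (simp add: field_simps)
    also have "\<dots> < mat_app A y i - m * y i" using gap by simp
    finally have em: "m * e < mat_app A y i - m * y i" .
    define y' where "y' = y(i := y i + e)"
    have app: "mat_app A y' k = mat_app A y k + A $$ (k, i) * e" for k
      unfolding y'_def using An(3) \<open>i < n\<close> by (simp add: mat_app_add_at)
    have nn: "0 \<le> A $$ (k, i) * e" if "k < n" for k
      using An(4)[OF that \<open>i < n\<close>] e0 by simp
    have less: "m * y' k < mat_app A y' k" if "k \<in> X" "k < n" for k
    proof (cases "k = i")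
      case True
      then show ?thesis
        using em nn[OF \<open>i < n\<close>] app[of i] by (simp add: y'_def distrib_left)
    next
      case False
      then show ?thesis using y(2)[OF that(1)] nn[OF that(2)] app[of k] by (simp add: y'_def)
    qed
    have "0 < A $$ (j, i) * e"
      using An(4)[OF \<open>j < n\<close> \<open>i < n\<close>] \<open>A $$ (j, i) \<noteq> 0\<close> e0 by simp
    moreover have "j \<noteq> i" using \<open>j \<notin> X\<close> \<open>i \<in> X\<close> by blast
    ultimately have "m * y' j < mat_app A y' j"
      using y(1)[OF \<open>j < n\<close>] app[of j] by (simp add: y'_def)
    then have X: "\<forall>k\<in>insert j X. m * y' k < mat_app A y' k"
      using less \<open>X \<subseteq> {..<n}\<close> by auto
    moreover have "z k \<le> y' k \<and> y' k < z k + d \<and> m * y' k \<le> mat_app A y' k" if "k < n" for k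
    proof (cases "k = i")
      case True
      then show ?thesis using X \<open>i \<in> X\<close> yi ed e0 by (auto simp: y'_def less_imp_le)
    next
      case False
      then show ?thesis using y(1)[OF that] nn[OF that] app[of k] by (simp add: y'_def)
    qed
    ultimately show ?case unfolding P_def by blast
  qed (use strict in auto)
  then show thesis using that unfolding P_def by (metis lessThan_iff)
qed

section \<open>Powers of nonnegative matrices\<close>

lemma nonneg_mats_smult:
  assumes "A \<in> nonneg_mats n" "0 \<le> c"
  shows "c \<cdot>\<^sub>m A \<in> nonneg_mats n"
  using assms by (auto simp: nonneg_mats_def)

lemma nonneg_mats_mult:
  assumes "A \<in> nonneg_mats n" "B \<in> nonneg_mats n"
  shows "A * B \<in> nonneg_mats n"
  using assms by (auto simp: nonneg_mats_def scalar_prod_def intro!: sum_nonneg mult_nonneg_nonneg)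

lemma nonneg_mats_pow:
  assumes "A \<in> nonneg_mats n"
  shows "A ^\<^sub>m k \<in> nonneg_mats n"
proof (induction k)
  case 0
  then show ?case using assms by (auto simp: nonneg_mats_def)
next
  case (Suc k)
  then show ?case using nonneg_mats_mult[OF Suc assms] by simp
qed

text \<open>The inequality can be iterated because powers of \<open>A\<close> are nonnegative and
  thus act monotonically.\<close>

lemma mat_app_pow_ge:
  assumes A: "A \<in> nonneg_mats n" and "0 \<le> q"
    and le: "\<And>i. i < n \<Longrightarrow> q * y i \<le> mat_app A y i" and "i < n"
  shows "q ^ k * y i \<le> mat_app (A ^\<^sub>m k) y i"
  using \<open>i < n\<close>
proof (induction k arbitrary: i)
  case 0
  have "(A ^\<^sub>m 0) $$ (i, j) * y j = (if j = i then y i else 0)" if "j < n" for j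
    using 0 that nonneg_matsD[OF A] by auto
  then have "mat_app (A ^\<^sub>m 0) y i = y i"
    using 0 nonneg_matsD[OF A] by (simp add: mat_app_def)
  then show ?case by simp
next
  case (Suc k)
  note Ak = nonneg_mats_pow[OF A, of k]
  have "q ^ Suc k * y i \<le> q * mat_app (A ^\<^sub>m k) y i"
    using Suc.IH[OF Suc.prems] \<open>0 \<le> q\<close> by (simp add: mult_left_mono mult.assoc)
  also have "\<dots> = mat_app (A ^\<^sub>m k) (\<lambda>j. q * y j) i" by (simp add: mat_app_scale)
  also have "\<dots> \<le> mat_app (A ^\<^sub>m k) (mat_app A y) i"
    by (rule mat_app_mono[OF Ak]) (use le Suc.prems in auto)
  also have "\<dots> = mat_app (A ^\<^sub>m Suc k) y i"
    using mat_app_mult[OF nonneg_matsD(1)[OF Ak] nonneg_matsD(1)[OF A] Suc.prems] by simp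
  finally show ?case .
qed

section \<open>Bounds on the spectral radius from test vectors\<close>

text \<open>The moduli of an eigenvector for an eigenvalue of maximal modulus; the inequality is the
  triangle inequality in each row.\<close>

lemma rho_subeigenvector:
  assumes A: "A \<in> nonneg_mats n" and "0 < n"
  obtains x where "\<And>i. i < n \<Longrightarrow> 0 \<le> x i" and "\<exists>i<n. x i \<noteq> 0"
    and "\<And>i. i < n \<Longrightarrow> rho A * x i \<le> mat_app A x i"
proof -
  let ?C = "map_mat complex_of_real A"
  note An = nonneg_matsD[OF A]
  have C: "?C \<in> carrier_mat n n" using An by simp
  from spectral_radius_mem_max(1)[OF C \<open>0 < n\<close>]
  obtain l where l: "eigenvalue ?C l" "rho A = norm l"
    by (auto simp: rho_def spectrum_def)
  then obtain v where v: "v \<in> carrier_vec n" "v \<noteq> 0\<^sub>v n" "?C *\<^sub>v v = l \<cdot>\<^sub>v v"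
    using C by (auto simp: eigenvalue_def eigenvector_def)
  define x where "x i = norm (v $ i)" for i
  show thesis
  proof
    show "\<exists>i<n. x i \<noteq> 0"
      using v(1,2) by (auto simp: x_def intro!: eq_vecI)
  next
    fix i assume i: "i < n"
    have "l * v $ i = (?C *\<^sub>v v) $ i" using v(1,3) i by simp
    also have "\<dots> = (\<Sum>j<n. complex_of_real (A $$ (i, j)) * v $ j)"
      using v(1) i An by (auto simp: scalar_prod_def atLeast0LessThan intro!: sum.cong)
    finally have "rho A * x i = norm (\<Sum>j<n. complex_of_real (A $$ (i, j)) * v $ j)"
      using l(2) by (simp add: x_def flip: norm_mult)
    also have "\<dots> \<le> (\<Sum>j<n. norm (complex_of_real (A $$ (i, j)) * v $ j))" by (rule norm_sum)
    also have "\<dots> = mat_app A x i"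
      using An i by (auto simp: mat_app_def x_def norm_mult intro!: sum.cong)
    finally show "rho A * x i \<le> mat_app A x i" .
  qed (simp add: x_def)
qed

lemma rho_nonneg:
  assumes "A \<in> nonneg_mats n" and "0 < n"
  shows "0 \<le> rho A"
proof -
  have "map_mat complex_of_real A \<in> carrier_mat n n" using nonneg_matsD[OF assms(1)] by simp
  from spectral_radius_mem_max(1)[OF this assms(2)] show ?thesis by (auto simp: rho_def)
qed

text \<open>Otherwise the powers of a suitably scaled \<open>A\<close> would be bounded although their action on
  \<open>y\<close> grows exponentially.\<close>

lemma rho_ge:
  assumes A: "A \<in> nonneg_mats n"
    and y: "\<And>i. i < n \<Longrightarrow> 0 \<le> y i" "i < n" "y i \<noteq> 0"
    and le: "\<And>i. i < n \<Longrightarrow> r * y i \<le> mat_app A y i"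
  shows "r \<le> rho A"
proof (rule ccontr)
  assume "\<not> r \<le> rho A"
  then have r: "rho A < r" by simp
  note An = nonneg_matsD[OF A]
  have n: "0 < n" using y(2) by simp
  \<comment> \<open>A midpoint: after division by \<open>s\<close> the spectral radius is below 1
    while the growth factor \<open>r / s\<close> exceeds 1.\<close>
  define s where "s = (rho A + r) / 2"
  have s: "0 < s" "rho A < s" "s < r"
    using rho_nonneg[OF A n] r by (auto simp: s_def)
  define B where "B = inverse s \<cdot>\<^sub>m A"
  have B: "B \<in> nonneg_mats n"
    unfolding B_def using A s(1) by (intro nonneg_mats_smult) auto
  note Bn = nonneg_matsD[OF B]
  let ?C = "map_mat complex_of_real B"
  have C: "?C \<in> carrier_mat n n" using Bn by simp
  \<comment> \<open>Multiplying an eigenvalue of \<open>B\<close> by \<open>s\<close> gives one of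
    \<open>A\<close>, of modulus at most \<open>rho A\<close>, which is below
    \<open>s\<close>.\<close>
  have "spectral_radius ?C < 1"
  proof -
    from spectral_radius_mem_max(1)[OF C n]
    obtain l v where l: "spectral_radius ?C = norm l"
      and v: "v \<in> carrier_vec n" "v \<noteq> 0\<^sub>v n" "?C *\<^sub>v v = l \<cdot>\<^sub>v v"
      using C by (auto simp: spectrum_def eigenvalue_def eigenvector_def)
    let ?A = "map_mat complex_of_real A"
    have A': "?A \<in> carrier_mat n n" using An by simp
    have "?A = complex_of_real s \<cdot>\<^sub>m ?C"
      using s(1) by (intro eq_matI) (auto simp: B_def)
    then have "?A *\<^sub>v v = complex_of_real s \<cdot>\<^sub>v (?C *\<^sub>v v)"
      using C v(1) by (intro eq_vecI) auto
    then have "?A *\<^sub>v v = (complex_of_real s * l) \<cdot>\<^sub>v v"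
      using v(3) by (simp add: smult_smult_assoc)
    then have "eigenvalue ?A (complex_of_real s * l)"
      using v(1,2) A' by (auto simp: eigenvalue_def eigenvector_def)
    then have "norm (complex_of_real s * l) \<le> rho A"
      unfolding rho_def by (intro spectral_radius_mem_max(2)[OF A' n]) (auto simp: spectrum_def)
    then have "s * norm l < s * 1" using s(1,2) by (simp only: norm_mult norm_of_real)
    then show ?thesis using l s(1) by simp
  qed
  \<comment> \<open>A spectral radius below 1 bounds the entries of all powers uniformly.\<close>
  from spectral_radius_jnf_norm_bound_less_1_upper_triangular[OF C this]
  obtain c where c: "\<And>k. norm_bound (?C ^\<^sub>m k) c" by blast
  have bound: "(B ^\<^sub>m k) $$ (i, j) \<le> c" if "j < n" for k j
  proof -
    have "?C ^\<^sub>m k = map_mat complex_of_real (B ^\<^sub>m k)"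
      by (rule of_real_hom.mat_hom_pow[OF Bn(1), symmetric])
    moreover have "B ^\<^sub>m k \<in> carrier_mat n n" using Bn(1) by simp
    ultimately have "norm (complex_of_real ((B ^\<^sub>m k) $$ (i, j))) \<le> c"
      using c[of k] that y(2) Bn(2,3) by (auto simp: norm_bound_def)
    then show ?thesis by (simp add: abs_le_iff)
  qed
  define q where "q = r / s"
  have q: "1 < q" using s by (simp add: q_def)
  have qB: "q * y i \<le> mat_app B y i" if "i < n" for i
  proof -
    have "mat_app B y i = inverse s * mat_app A y i"
      using An that by (simp add: mat_app_def B_def sum_distrib_left mult_ac)
    then show ?thesis using le[OF that] s(1) by (simp add: q_def field_simps)
  qed
  have "q ^ k * y i \<le> c * (\<Sum>j<n. y j)" for k
  proof -
    have "q ^ k * y i \<le> mat_app (B ^\<^sub>m k) y i"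
      by (rule mat_app_pow_ge[OF B _ qB y(2)]) (use q in auto)
    also have "\<dots> \<le> (\<Sum>j<n. c * y j)"
      unfolding mat_app_def nonneg_matsD(3)[OF nonneg_mats_pow[OF B]] using bound y(1)
      by (intro sum_mono mult_right_mono) auto
    finally show ?thesis by (simp add: sum_distrib_left)
  qed
  moreover have "0 < y i" using y by (simp add: order_less_le)
  ultimately have "q ^ k \<le> c * (\<Sum>j<n. y j) / y i" for k
    by (simp add: le_divide_eq)
  moreover obtain k where "c * (\<Sum>j<n. y j) / y i < q ^ k"
    using real_arch_pow[OF q] by blast
  ultimately show False by (meson not_less)
qed

text \<open>The Collatz-Wielandt upper bound: a sub-eigenvector \<open>x\<close> for
  \<open>rho A\<close> is compared with \<open>v\<close> at an index where \<open>x i / v i\<close>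
  is maximal.\<close>

lemma rho_le:
  assumes A: "A \<in> nonneg_mats n" and n: "0 < n"
    and v: "\<And>i. i < n \<Longrightarrow> 0 < v i"
    and le: "\<And>i. i < n \<Longrightarrow> mat_app A v i \<le> m * v i"
  shows "rho A \<le> m"
proof -
  obtain x where x: "\<And>i. i < n \<Longrightarrow> 0 \<le> x i" "\<exists>i<n. x i \<noteq> 0"
      "\<And>i. i < n \<Longrightarrow> rho A * x i \<le> mat_app A x i"
    using rho_subeigenvector[OF A n] by blast
  obtain i0 where "i0 < n" "x i0 \<noteq> 0" using x(2) by blast
  then obtain i k where i: "i < n" "0 < k" "x i = k * v i" "mat_app A x i \<le> k * mat_app A v i"
    using mat_app_ratio_max[OF A, where v = v and x = x] v x(1) by blast
  have "k * v i * rho A \<le> mat_app A x i"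
    using x(3)[OF i(1)] by (simp add: i(3) mult_ac)
  also have "\<dots> \<le> k * mat_app A v i" by (rule i(4))
  also have "\<dots> \<le> k * (m * v i)" using le[OF i(1)] i(2) by simp
  finally show ?thesis using i(2) v[OF i(1)] by (simp add: mult_ac)
qed

text \<open>There are finitely many rows, so the largest quotient \<open>mat_app A v i / v i\<close>
  is still below \<open>m\<close>.\<close>

lemma rho_less:
  assumes A: "A \<in> nonneg_mats n" and n: "0 < n"
    and v: "\<And>i. i < n \<Longrightarrow> 0 < v i"
    and less: "\<And>i. i < n \<Longrightarrow> mat_app A v i < m * v i"
  shows "rho A < m"
proof -
  define k where "k = Max ((\<lambda>i. mat_app A v i / v i) ` {..<n})"
  have "k \<in> (\<lambda>i. mat_app A v i / v i) ` {..<n}"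
    unfolding k_def using n by (intro Max_in) auto
  then have "k < m" using less v by (auto simp: divide_less_eq)
  moreover have "mat_app A v i / v i \<le> k" if "i < n" for i
    unfolding k_def using that by (intro Max_ge) auto
  then have "mat_app A v i \<le> k * v i" if "i < n" for i
    using that v[OF that] by (simp add: divide_le_eq)
  then have "rho A \<le> k" using rho_le[OF A n, of v k] v by blast
  ultimately show ?thesis by simp
qed

lemma rho_greater:
  assumes A: "A \<in> nonneg_mats n" and n: "0 < n"
    and v: "\<And>i. i < n \<Longrightarrow> 0 \<le> v i" "i0 < n" "v i0 \<noteq> 0"
    and less: "\<And>i. i < n \<Longrightarrow> m * v i < mat_app A v i"
  shows "m < rho A"
proof -
  \<comment> \<open>Since \<open>v i\<close> may be 0, the slack is divided by
    \<open>v i + 1\<close>; the minimum over the rows is an admissible increase of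
    \<open>m\<close>.\<close>
  define k where "k = Min ((\<lambda>i. (mat_app A v i - m * v i) / (v i + 1)) ` {..<n})"
  have "k \<in> (\<lambda>i. (mat_app A v i - m * v i) / (v i + 1)) ` {..<n}"
    unfolding k_def using n by (intro Min_in) auto
  then have k: "0 < k" using less v(1) by (auto intro!: divide_pos_pos add_nonneg_pos)
  have kle: "k \<le> (mat_app A v i - m * v i) / (v i + 1)" if "i < n" for i
    unfolding k_def using that by (intro Min_le) auto
  have "(m + k) * v i \<le> mat_app A v i" if "i < n" for i
  proof -
    have "k * v i \<le> k * (v i + 1)" using k by simp
    also have "\<dots> \<le> mat_app A v i - m * v i"
      using kle[OF that] v(1)[OF that] by (simp add: le_divide_eq)
    finally show ?thesis by (simp add: algebra_simps)
  qed
  then have "m + k \<le> rho A" using rho_ge[OF A, of v i0 "m + k"] v by blast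
  then show ?thesis using k by simp
qed

text \<open>Strictness spreads from one row to all. The spreading argument concerns lower bounds, so
  it is applied to the negative of \<open>v\<close>.\<close>

lemma rho_less_irreducible:
  assumes A: "A \<in> nonneg_mats n" and irr: "irreducible_mat A"
    and v: "\<And>i. i < n \<Longrightarrow> 0 < v i"
    and le: "\<And>i. i < n \<Longrightarrow> mat_app A v i \<le> m * v i"
    and strict: "i0 < n" "mat_app A v i0 < m * v i0"
  shows "rho A < m"
proof -
  \<comment> \<open>Raising \<open>- v\<close> by less than the smallest entry of \<open>v\<close>
    leaves it negative everywhere.\<close>
  define d where "d = Min (v ` {..<n})"
  have "d \<in> v ` {..<n}" unfolding d_def using strict(1) by (intro Min_in) auto
  then have d: "0 < d" using v by auto
  have dle: "d \<le> v i" if "i < n" for i unfolding d_def using that by (intro Min_le) auto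
  obtain y where y: "\<And>i. i < n \<Longrightarrow> y i < - v i + d" "\<And>i. i < n \<Longrightarrow> m * y i < mat_app A y i"
    using irreducible_mat_strict_everywhere[OF A irr, of m "\<lambda>i. - v i" i0 d] le strict d
    unfolding mat_app_uminus by (metis mult_minus_right neg_le_iff_le neg_less_iff_less)
  show ?thesis
  proof (rule rho_less[OF A])
    show "0 < n" using strict(1) by simp
    show "0 < - y i" if "i < n" for i using y(1)[OF that] dle[OF that] by simp
    show "mat_app A (\<lambda>i. - y i) i < m * - y i" if "i < n" for i
      using y(2)[OF that] by (simp add: mat_app_uminus)
  qed
qed

text \<open>Strictness spreads to all rows; the vector only grows in the process, hence stays
  nonnegative and nonzero.\<close>

lemma rho_greater_irreducible:
  assumes A: "A \<in> nonneg_mats n" and irr: "irreducible_mat A"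
    and v: "\<And>i. i < n \<Longrightarrow> 0 \<le> v i" "i1 < n" "v i1 \<noteq> 0"
    and le: "\<And>i. i < n \<Longrightarrow> m * v i \<le> mat_app A v i"
    and strict: "i0 < n" "m * v i0 < mat_app A v i0"
  shows "m < rho A"
proof (rule irreducible_mat_strict_everywhere[OF A irr, of m v i0 1])
  fix y assume y: "\<And>i. i < n \<Longrightarrow> v i \<le> y i" "\<And>i. i < n \<Longrightarrow> m * y i < mat_app A y i"
  show ?thesis
  proof (rule rho_greater[OF A])
    show "0 < n" using strict(1) by simp
    show "0 \<le> y i" if "i < n" for i using y(1)[OF that] v(1)[OF that] by simp
    show "i1 < n" by fact
    show "y i1 \<noteq> 0" using y(1)[OF v(2)] v(1)[OF v(2)] v(3) by simp
  qed (rule y(2))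
qed (use le strict in auto)

lemma perron_eigenvector:
  assumes A: "A \<in> nonneg_mats n" and irr: "irreducible_mat A"
  obtains v where "\<And>i. i < n \<Longrightarrow> 0 < v i" and "\<And>i. i < n \<Longrightarrow> mat_app A v i = rho A * v i"
proof -
  note An = nonneg_matsD[OF A]
  have n: "0 < n" using irreducible_mat_dim_pos[OF irr An(1)] .
  obtain x where x: "\<And>i. i < n \<Longrightarrow> 0 \<le> x i" "\<exists>i<n. x i \<noteq> 0"
      "\<And>i. i < n \<Longrightarrow> rho A * x i \<le> mat_app A x i"
    using rho_subeigenvector[OF A n] by blast
  then obtain i1 where i1: "i1 < n" "x i1 \<noteq> 0" by blast
  \<comment> \<open>A strict row would give \<open>rho A < rho A\<close>, so the sub-eigenvector is
    an eigenvector.\<close>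
  have eq: "mat_app A x i = rho A * x i" if "i < n" for i
    using rho_greater_irreducible[OF A irr x(1) i1 x(3) that] x(3)[OF that] by fastforce
  \<comment> \<open>A positive coordinate forces positivity at every vertex with an arc to it, and
    so, by growth, everywhere.\<close>
  from irr An(1) have "\<forall>i\<in>{..<n}. 0 < x i"
  proof (induction rule: irreducible_mat_grow_induct[where X = "{i1}" and P = "\<lambda>X. \<forall>i\<in>X. 0 < x i"])
    case (step X i j)
    then have "0 < A $$ (i, j) * x j"
      using An(4)[of i j] by simp
    also have "\<dots> \<le> mat_app A x i"
      unfolding mat_app_def using step An x(1) by (intro member_le_sum) auto
    also have "\<dots> = rho A * x i" using eq step by simp
    finally have "x i \<noteq> 0" by auto
    then show ?case using step x(1)[of i] by auto
  qed (use i1 x(1)[of i1] in auto)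
  then show thesis using that[of x] eq by auto
qed

section \<open>Cycle means and auxiliary matrices\<close>

lemma prod_list_map_divide_const:
  fixes c :: "'b \<Rightarrow> real"
  shows "prod_list (map (\<lambda>e. c e / m) p) = prod_list (map c p) / m ^ length p"
  by (induction p) auto

lemma prod_list_map_const_divide:
  fixes c :: "'b \<Rightarrow> real"
  shows "prod_list (map (\<lambda>e. m / c e) p) = m ^ length p / prod_list (map c p)"
  by (induction p) auto

abbreviation mat_cycle :: "real mat \<Rightarrow> (nat \<times> nat) list \<Rightarrow> bool" where
  "mat_cycle B \<equiv> pre_digraph.cycle (with_proj (mat_digraph B))"

abbreviation arc_prod :: "real mat \<Rightarrow> (nat \<times> nat) list \<Rightarrow> real" where
  "arc_prod B p \<equiv> prod_list (map (\<lambda>e. B $$ e) p)"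

lemma mat_cycleD:
  assumes "B \<in> carrier_mat n n" and "mat_cycle B p"
  shows "p \<noteq> []" and "\<And>i j. (i, j) \<in> set p \<Longrightarrow> i < n \<and> j < n \<and> B $$ (i, j) \<noteq> 0"
proof -
  interpret fin_digraph "with_proj (mat_digraph B)"
    using fin_digraph_mat_digraph[OF assms(1)] .
  show "p \<noteq> []" using assms(2) by (auto simp: cycle_def)
  show "i < n \<and> j < n \<and> B $$ (i, j) \<noteq> 0" if "(i, j) \<in> set p" for i j
  proof -
    have "(i, j) \<in> arcs (with_proj (mat_digraph B))"
      using that assms(2) by (auto simp: cycle_def awalk_def)
    then show ?thesis using assms(1) by (simp add: mat_digraph_def)
  qed
qed

lemma arc_prod_pos:
  assumes "B \<in> nonneg_mats n" and "mat_cycle B p"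
  shows "0 < arc_prod B p"
proof -
  have "0 < B $$ e" if "e \<in> set p" for e
    using that mat_cycleD(2)[OF nonneg_matsD(1)[OF assms(1)] assms(2), of "fst e" "snd e"]
      nonneg_matsD(4)[OF assms(1), of "fst e" "snd e"] by (simp add: order_less_le)
  then have "0 < prod_list (map (\<lambda>e. B $$ e) q)" if "set q \<subseteq> set p" for q
    using that by (induction q) auto
  then show ?thesis by simp
qed

lemma cycle_mean_pow:
  assumes "B \<in> nonneg_mats n" and "mat_cycle B p"
  shows "cycle_mean B p ^ length p = arc_prod B p" and "0 < cycle_mean B p"
  using mat_cycleD(1)[OF nonneg_matsD(1)[OF assms(1)] assms(2)] arc_prod_pos[OF assms]
  by (auto simp: cycle_mean_def real_root_pow_pos)

text \<open>The arcs of a cycle are distinct, which leaves finitely many cycles. Hence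
  \<open>Max\<close> and \<open>Min\<close> are attained.\<close>

lemma finite_cycle_means:
  assumes "B \<in> carrier_mat n n"
  shows "finite (cycle_means B)"
proof -
  interpret fin_digraph "with_proj (mat_digraph B)"
    using fin_digraph_mat_digraph[OF assms] .
  have "{p. cycle p} \<subseteq> {p. distinct p \<and> set p \<subseteq> arcs (with_proj (mat_digraph B))}"
    by (auto simp: cycle_conv awalk_def)
  moreover have "finite {p. distinct p \<and> set p \<subseteq> arcs (with_proj (mat_digraph B))}"
    using finite_subset_distinct[OF finite_arcs] by (simp add: conj_commute)
  ultimately show ?thesis
    unfolding cycle_means_def by (meson finite_imageI finite_subset)
qed

lemma mu_attained:
  assumes B: "B \<in> nonneg_mats n" and "cycle_means B \<noteq> {}"
  obtains p where "mat_cycle B p" "arc_prod B p = mu B ^ length p" "0 < mu B"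
proof -
  have "mu B \<in> cycle_means B"
    using assms finite_cycle_means[OF nonneg_matsD(1)[OF B]] by (simp add: mu_def)
  then show thesis using that cycle_mean_pow[OF B] by (auto simp: cycle_means_def)
qed

lemma nu_attained:
  assumes B: "B \<in> nonneg_mats n" and "cycle_means B \<noteq> {}"
  obtains p where "mat_cycle B p" "arc_prod B p = nu B ^ length p" "0 < nu B"
proof -
  have "nu B \<in> cycle_means B"
    using assms finite_cycle_means[OF nonneg_matsD(1)[OF B]] by (simp add: nu_def)
  then show thesis using that cycle_mean_pow[OF B] by (auto simp: cycle_means_def)
qed

lemma nu_le_cycle_mean_le_mu:
  assumes "B \<in> carrier_mat n n" and "mat_cycle B p"
  shows "nu B \<le> cycle_mean B p" and "cycle_mean B p \<le> mu B"
  using assms finite_cycle_means[OF assms(1)] by (auto simp: nu_def mu_def cycle_means_def)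

lemma arc_prod_le_mu:
  assumes B: "B \<in> nonneg_mats n" and "mat_cycle B p"
  shows "arc_prod B p \<le> mu B ^ length p"
proof -
  have "cycle_mean B p ^ length p \<le> mu B ^ length p"
    using nu_le_cycle_mean_le_mu[OF nonneg_matsD(1)[OF B] assms(2)] cycle_mean_pow[OF assms]
    by (intro power_mono) auto
  then show ?thesis using cycle_mean_pow[OF assms] by simp
qed

lemma arc_prod_ge_nu:
  assumes B: "B \<in> nonneg_mats n" and "mat_cycle B p"
  shows "nu B ^ length p \<le> arc_prod B p"
proof -
  have "cycle_means B \<noteq> {}" using assms(2) by (auto simp: cycle_means_def)
  then have "0 < nu B" using nu_attained[OF B] by metis
  then have "nu B ^ length p \<le> cycle_mean B p ^ length p"
    using nu_le_cycle_mean_le_mu[OF nonneg_matsD(1)[OF B] assms(2)] by (intro power_mono) auto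
  then show ?thesis using cycle_mean_pow[OF assms] by simp
qed

text \<open>Each arc weight rescaled by \<open>v\<close> equals \<open>m\<close>, and the potential
  cancels around the cycle.\<close>

lemma cycle_mean_eqI:
  assumes B: "B \<in> nonneg_mats n" and p: "mat_cycle B p"
    and v: "\<And>i. i < n \<Longrightarrow> 0 < v i" and "0 < m"
    and eq: "\<And>i j. i < n \<Longrightarrow> j < n \<Longrightarrow> B $$ (i, j) \<noteq> 0 \<Longrightarrow> B $$ (i, j) * v j = m * v i"
  shows "cycle_mean B p = m"
proof -
  note Bn = nonneg_matsD[OF B]
  interpret fin_digraph "with_proj (mat_digraph B)"
    using fin_digraph_mat_digraph[OF Bn(1)] .
  obtain u where u: "awalk u p u" using p by (auto simp: cycle_def)
  have V: "verts (with_proj (mat_digraph B)) = {..<n}" using Bn by (simp add: mat_digraph_def)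
  have un: "u < n" using u V by (auto simp: awalk_def)
  have "arc_prod B p = arc_prod B p * v u / v u" using v[OF un] by simp
  also have "\<dots> = prod_list (map (\<lambda>e. B $$ e * v (snd e) / v (fst e)) p)"
    using awalk_telescope[OF u, of v "\<lambda>e. B $$ e"] v V by (simp add: less_imp_neq[THEN not_sym])
  also have "map (\<lambda>e. B $$ e * v (snd e) / v (fst e)) p = map (\<lambda>e. m) p"
  proof (rule map_cong[OF refl])
    fix e assume "e \<in> set p"
    then have "fst e < n \<and> snd e < n \<and> B $$ (fst e, snd e) \<noteq> 0"
      using mat_cycleD(2)[OF Bn(1) p, of "fst e" "snd e"] by simp
    then show "B $$ e * v (snd e) / v (fst e) = m"
      using eq[of "fst e" "snd e"] v[of "fst e"] by simp
  qed
  also have "prod_list (map (\<lambda>e. m) p) = m ^ length p" by (induction p) auto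
  finally show ?thesis
    using mat_cycleD(1)[OF Bn(1) p] \<open>0 < m\<close> by (simp add: cycle_mean_def real_root_power_cancel)
qed

section \<open>Potentials and growth vectors of a matrix\<close>

text \<open>Dividing by \<open>m\<close> brings every cycle product to at most 1. If
  \<open>B\<close> has no cycle, every positive \<open>m\<close> qualifies.\<close>

lemma potential_upper:
  assumes B: "B \<in> nonneg_mats n" and "0 < m"
    and le: "\<And>p. mat_cycle B p \<Longrightarrow> arc_prod B p \<le> m ^ length p"
  obtains v where "\<And>i. i < n \<Longrightarrow> 0 < v i"
    and "\<And>i j. i < n \<Longrightarrow> j < n \<Longrightarrow> B $$ (i, j) \<noteq> 0 \<Longrightarrow> B $$ (i, j) * v j \<le> m * v i"
proof -
  note Bn = nonneg_matsD[OF B]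
  interpret fin_digraph "with_proj (mat_digraph B)"
    using fin_digraph_mat_digraph[OF Bn(1)] .
  have pos: "0 < B $$ e / m" if "e \<in> arcs (with_proj (mat_digraph B))" for e
    using that Bn \<open>0 < m\<close> by (auto simp: mat_digraph_def order_less_le)
  have cyc: "prod_list (map (\<lambda>e. B $$ e / m) p) \<le> 1" if "cycle p" for p
    using le[OF that] \<open>0 < m\<close> by (simp add: prod_list_map_divide_const)
  obtain v where v: "\<And>u. u \<in> verts (with_proj (mat_digraph B)) \<Longrightarrow> 0 < v u"
      "\<And>e. e \<in> arcs (with_proj (mat_digraph B)) \<Longrightarrow> B $$ e / m * v (snd e) \<le> v (fst e)"
    using cycle_potential[OF pos cyc] by auto
  show thesis
  proof
    show "0 < v i" if "i < n" for i using v(1) that Bn(2) by (simp add: mat_digraph_def)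
    show "B $$ (i, j) * v j \<le> m * v i" if "i < n" "j < n" "B $$ (i, j) \<noteq> 0" for i j
    proof -
      have "B $$ (i, j) / m * v j \<le> v i"
        using v(2)[of "(i, j)"] that Bn(2,3) by (simp add: mat_digraph_def)
      then show ?thesis using \<open>0 < m\<close> by (simp add: field_simps)
    qed
  qed
qed

text \<open>The reciprocal weights \<open>m / B $$ e\<close> turn lower bounds into upper ones; the
  inverses of their potential are as required.\<close>

lemma potential_lower:
  assumes B: "B \<in> nonneg_mats n" and "0 < m"
    and ge: "\<And>p. mat_cycle B p \<Longrightarrow> m ^ length p \<le> arc_prod B p"
  obtains v where "\<And>i. i < n \<Longrightarrow> 0 < v i"
    and "\<And>i j. i < n \<Longrightarrow> j < n \<Longrightarrow> B $$ (i, j) \<noteq> 0 \<Longrightarrow> m * v i \<le> B $$ (i, j) * v j"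
proof -
  note Bn = nonneg_matsD[OF B]
  interpret fin_digraph "with_proj (mat_digraph B)"
    using fin_digraph_mat_digraph[OF Bn(1)] .
  have pos: "0 < m / B $$ e" if "e \<in> arcs (with_proj (mat_digraph B))" for e
    using that Bn \<open>0 < m\<close> by (auto simp: mat_digraph_def order_less_le)
  have cyc: "prod_list (map (\<lambda>e. m / B $$ e) p) \<le> 1" if "cycle p" for p
    using ge[OF that] arc_prod_pos[OF B that] by (simp add: prod_list_map_const_divide)
  obtain v where v: "\<And>u. u \<in> verts (with_proj (mat_digraph B)) \<Longrightarrow> 0 < v u"
      "\<And>e. e \<in> arcs (with_proj (mat_digraph B)) \<Longrightarrow> m / B $$ e * v (snd e) \<le> v (fst e)"
    using cycle_potential[OF pos cyc] by auto
  have "0 < v i" if "i < n" for i using v(1) that Bn by (simp add: mat_digraph_def)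
  moreover have "m * inverse (v i) \<le> B $$ (i, j) * inverse (v j)"
    if "i < n" "j < n" "B $$ (i, j) \<noteq> 0" for i j
  proof -
    have "0 < B $$ (i, j)" using Bn(4)[OF that(1,2)] that(3) by simp
    moreover have "m / B $$ (i, j) * v j \<le> v i"
      using v(2)[of "(i, j)"] that Bn by (simp add: mat_digraph_def)
    ultimately show ?thesis
      using v(1)[of i] v(1)[of j] that Bn by (simp add: mat_digraph_def field_simps)
  qed
  ultimately show thesis by (intro that[of "\<lambda>i. inverse (v i)"]) auto
qed

text \<open>A cycle of mean \<open>mu B\<close> is critical for the weights
  \<open>B $$ e / mu B\<close>, and \<open>r / mu B\<close> is the factor below 1.\<close>

lemma growth_upper:
  assumes B: "B \<in> nonneg_mats n" and irr: "irreducible_mat B" and ne: "cycle_means B \<noteq> {}"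
    and r: "0 < r" "r < mu B"
  obtains v where "\<And>i. i < n \<Longrightarrow> 0 < v i"
    and "\<And>i. i < n \<Longrightarrow> \<exists>j<n. B $$ (i, j) \<noteq> 0 \<and> r * v i < B $$ (i, j) * v j"
proof -
  note Bn = nonneg_matsD[OF B]
  interpret fin_digraph "with_proj (mat_digraph B)"
    using fin_digraph_mat_digraph[OF Bn(1)] .
  let ?G = "with_proj (mat_digraph B)"
  obtain p where p: "mat_cycle B p" "arc_prod B p = mu B ^ length p" and m: "0 < mu B"
    using mu_attained[OF B ne] .
  have pos: "0 < B $$ e / mu B" if "e \<in> arcs ?G" for e
    using that Bn m by (auto simp: mat_digraph_def order_less_le)
  have cyc: "prod_list (map (\<lambda>e. B $$ e / mu B) p) \<le> 1" if "cycle p" for p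
    using arc_prod_le_mu[OF B that] m by (simp add: prod_list_map_divide_const)
  have crit: "prod_list (map (\<lambda>e. B $$ e / mu B) p) = 1"
    using p m by (simp add: prod_list_map_divide_const)
  have s: "0 < r / mu B" "r / mu B < 1" using r m by auto
  obtain v where v: "\<And>u. u \<in> verts ?G \<Longrightarrow> 0 < v u"
      "\<And>u. u \<in> verts ?G \<Longrightarrow> \<exists>e\<in>arcs ?G. tail ?G e = u \<and> r / mu B * v u < B $$ e / mu B * v (head ?G e)"
    using critical_cycle_growth[OF irr[unfolded irreducible_mat_def] pos cyc p(1) crit s] by blast
  show thesis
  proof
    show "0 < v i" if "i < n" for i using v(1) that Bn by (simp add: mat_digraph_def)
    show "\<exists>j<n. B $$ (i, j) \<noteq> 0 \<and> r * v i < B $$ (i, j) * v j" if "i < n" for i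
    proof -
      have "i \<in> verts ?G" using that Bn(2) by (simp add: mat_digraph_def)
      from v(2)[OF this] obtain j where "(i, j) \<in> arcs ?G" "r / mu B * v i < B $$ (i, j) / mu B * v j"
        by auto
      then show ?thesis using m Bn
        by (intro exI[of _ j]) (auto simp: mat_digraph_def divide_less_cancel)
    qed
  qed
qed

text \<open>Dually, a cycle of mean \<open>nu B\<close> is critical for the weights
  \<open>nu B / B $$ e\<close>, the factor is \<open>nu B / r\<close>, and the resulting vector is
  inverted.\<close>

lemma growth_lower:
  assumes B: "B \<in> nonneg_mats n" and irr: "irreducible_mat B" and ne: "cycle_means B \<noteq> {}"
    and r: "nu B < r"
  obtains v where "\<And>i. i < n \<Longrightarrow> 0 < v i"
    and "\<And>i. i < n \<Longrightarrow> \<exists>j<n. B $$ (i, j) \<noteq> 0 \<and> B $$ (i, j) * v j < r * v i"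
proof -
  note Bn = nonneg_matsD[OF B]
  interpret fin_digraph "with_proj (mat_digraph B)"
    using fin_digraph_mat_digraph[OF Bn(1)] .
  let ?G = "with_proj (mat_digraph B)"
  obtain p where p: "mat_cycle B p" "arc_prod B p = nu B ^ length p" and m: "0 < nu B"
    using nu_attained[OF B ne] .
  have pos: "0 < nu B / B $$ e" if "e \<in> arcs ?G" for e
    using that Bn m by (auto simp: mat_digraph_def order_less_le)
  have cyc: "prod_list (map (\<lambda>e. nu B / B $$ e) p) \<le> 1" if "cycle p" for p
    using arc_prod_ge_nu[OF B that] arc_prod_pos[OF B that]
    by (simp add: prod_list_map_const_divide)
  have crit: "prod_list (map (\<lambda>e. nu B / B $$ e) p) = 1"
    using p m by (simp add: prod_list_map_const_divide)
  have s: "0 < nu B / r" "nu B / r < 1" using r m by auto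
  obtain v where v: "\<And>u. u \<in> verts ?G \<Longrightarrow> 0 < v u"
      "\<And>u. u \<in> verts ?G \<Longrightarrow> \<exists>e\<in>arcs ?G. tail ?G e = u \<and> nu B / r * v u < nu B / B $$ e * v (head ?G e)"
    using critical_cycle_growth[OF irr[unfolded irreducible_mat_def] pos cyc p(1) crit s] by blast
  have vpos: "0 < v i" if "i < n" for i using v(1) that Bn by (simp add: mat_digraph_def)
  show thesis
  proof
    show "0 < inverse (v i)" if "i < n" for i using vpos[OF that] by simp
    show "\<exists>j<n. B $$ (i, j) \<noteq> 0 \<and> B $$ (i, j) * inverse (v j) < r * inverse (v i)" if "i < n" for i
    proof -
      have "i \<in> verts ?G" using that Bn(2) by (simp add: mat_digraph_def)
      from v(2)[OF this] obtain j where j: "(i, j) \<in> arcs ?G" "nu B / r * v i < nu B / B $$ (i, j) * v j"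
        by auto
      then have jn: "j < n" "B $$ (i, j) \<noteq> 0" using Bn by (auto simp: mat_digraph_def)
      then have b: "0 < B $$ (i, j)" using Bn(4)[OF that jn(1)] by simp
      have "nu B * (v i / r) < nu B * (v j / B $$ (i, j))" using j(2) by (simp add: mult_ac)
      then have "v i / r < v j / B $$ (i, j)" by (simp only: mult_less_cancel_left_pos[OF m])
      then have "B $$ (i, j) * inverse (v j) < r * inverse (v i)"
        using b m r vpos[OF that] vpos[OF jn(1)] by (simp add: field_simps)
      then show ?thesis using jn by blast
    qed
  qed
qed

text \<open>A cycle provides one such row, and every vertex added by growth comes with an outgoing
  arc. Having a cycle rules out the zero matrix of size 1.\<close>

lemma exists_arc_in_row:
  assumes B: "B \<in> nonneg_mats n" and irr: "irreducible_mat B" and ne: "cycle_means B \<noteq> {}"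
    and "i < n"
  shows "\<exists>j<n. B $$ (i, j) \<noteq> 0"
proof -
  note Bn = nonneg_matsD[OF B]
  obtain p where p: "mat_cycle B p" using ne by (auto simp: cycle_means_def)
  obtain a b where ab: "a < n" "b < n" "B $$ (a, b) \<noteq> 0"
    using mat_cycleD[OF Bn(1) p] by (metis list.set_intros(1) neq_Nil_conv surj_pair)
  from irr Bn(1) have "\<forall>i\<in>{..<n}. \<exists>j<n. B $$ (i, j) \<noteq> 0"
    by (rule irreducible_mat_grow_induct[where X = "{a}" and P = "\<lambda>X. \<forall>i\<in>X. \<exists>j<n. B $$ (i, j) \<noteq> 0"])
      (use ab in auto)
  then show ?thesis using \<open>i < n\<close> by simp
qed

section \<open>Matrices with a prescribed auxiliary matrix\<close>

lemma row_sum_eq_0D: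
  assumes A: "A \<in> nonneg_mats n" and "i < n" and "(\<Sum>k<n. A $$ (i, k)) = 0" and "j < n"
  shows "A $$ (i, j) = 0"
proof -
  have "(\<Sum>k<n. A $$ (i, k)) = 0 \<longleftrightarrow> (\<forall>k\<in>{..<n}. A $$ (i, k) = 0)"
    using nonneg_matsD(4)[OF A \<open>i < n\<close>] by (intro sum_nonneg_eq_0_iff) auto
  then show ?thesis using assms(3,4) by blast
qed

text \<open>A nonnegative row with a nonzero entry has nonzero sum, so \<open>Aux\<close> preserves
  the support.\<close>

lemma Aux_D:
  assumes A: "A \<in> nonneg_mats n" and Aux: "Aux A = B" and ij: "i < n" "j < n"
  shows "A $$ (i, j) \<noteq> 0 \<longleftrightarrow> B $$ (i, j) \<noteq> 0"
    and "A $$ (i, j) \<noteq> 0 \<Longrightarrow> B $$ (i, j) = (\<Sum>k<n. A $$ (i, k))"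
proof -
  note An = nonneg_matsD[OF A]
  have B: "B $$ (i, j) = (if A $$ (i, j) \<noteq> 0 then \<Sum>k<n. A $$ (i, k) else 0)"
    using An ij by (simp add: Aux[symmetric] Aux_def)
  have "(\<Sum>k<n. A $$ (i, k)) \<noteq> 0" if "A $$ (i, j) \<noteq> 0"
    using that row_sum_eq_0D[OF A ij(1) _ ij(2)] by blast
  then show "A $$ (i, j) \<noteq> 0 \<longleftrightarrow> B $$ (i, j) \<noteq> 0" using B by auto
  show "B $$ (i, j) = (\<Sum>k<n. A $$ (i, k))" if "A $$ (i, j) \<noteq> 0" using B that by simp
qed

lemma Aux_eqI:
  assumes A: "A \<in> nonneg_mats n" and B: "B \<in> nonneg_mats n"
    and "\<And>i j. i < n \<Longrightarrow> j < n \<Longrightarrow> A $$ (i, j) \<noteq> 0 \<longleftrightarrow> B $$ (i, j) \<noteq> 0"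
    and "\<And>i j. i < n \<Longrightarrow> j < n \<Longrightarrow> B $$ (i, j) \<noteq> 0 \<Longrightarrow> (\<Sum>k<n. A $$ (i, k)) = B $$ (i, j)"
  shows "Aux A = B"
  using nonneg_matsD[OF A] nonneg_matsD[OF B] assms(3,4) by (intro eq_matI) (auto simp: Aux_def)

lemma Aux_irreducible:
  assumes A: "A \<in> nonneg_mats n" and "Aux A = B" and "irreducible_mat B"
  shows "irreducible_mat A"
proof -
  have "dim_row (Aux A) = n" "dim_col (Aux A) = n"
    using nonneg_matsD[OF A] by (auto simp: Aux_def)
  then have "mat_digraph A = mat_digraph (Aux A)"
    using Aux_D(1)[OF A refl] nonneg_matsD(2,3)[OF A] by (auto simp: mat_digraph_def)
  then show ?thesis using assms by (simp add: irreducible_mat_def)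
qed

text \<open>On the support the row sum is the entry of \<open>B\<close>. The defect of row
  \<open>i\<close> is thus an average of the defects of its arcs, weighted by row \<open>i\<close>
  of \<open>A\<close>; multiplying by the row sum avoids dividing by zero.\<close>

lemma Aux_row_identity:
  assumes A: "A \<in> nonneg_mats n" and Aux: "Aux A = B" and "i < n"
  shows "(\<Sum>j<n. A $$ (i, j)) * (m * v i - mat_app A v i)
    = (\<Sum>j<n. A $$ (i, j) * (m * v i - B $$ (i, j) * v j))"
proof -
  let ?R = "\<Sum>j<n. A $$ (i, j)"
  have "?R * mat_app A v i = (\<Sum>j<n. ?R * (A $$ (i, j) * v j))"
    using nonneg_matsD[OF A] by (simp add: mat_app_def sum_distrib_left)
  also have "\<dots> = (\<Sum>j<n. A $$ (i, j) * (B $$ (i, j) * v j))"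
    using Aux_D(2)[OF A Aux \<open>i < n\<close>] by (intro sum.cong) auto
  finally show ?thesis
    by (simp add: right_diff_distrib sum_subtractf sum_distrib_right)
qed

lemma Aux_mat_app_le:
  assumes A: "A \<in> nonneg_mats n" and Aux: "Aux A = B" and i: "i < n" and "0 \<le> m * v i"
    and le: "\<And>j. j < n \<Longrightarrow> B $$ (i, j) \<noteq> 0 \<Longrightarrow> B $$ (i, j) * v j \<le> m * v i"
  shows "mat_app A v i \<le> m * v i"
proof (cases "(\<Sum>j<n. A $$ (i, j)) = 0")
  \<comment> \<open>A zero row offers no average; the left side is 0 and the sign of
    \<open>m * v i\<close> decides.\<close>
  case True
  then have "\<forall>j<n. A $$ (i, j) = 0"
    using row_sum_eq_0D[OF A i] by blast
  then show ?thesis using assms(4) nonneg_matsD[OF A] by (simp add: mat_app_def)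
next
  case False
  moreover have "0 \<le> (\<Sum>j<n. A $$ (i, j))"
    using nonneg_matsD[OF A] i by (intro sum_nonneg) auto
  ultimately have R: "0 < (\<Sum>j<n. A $$ (i, j))" by simp
  have "0 \<le> A $$ (i, j) * (m * v i - B $$ (i, j) * v j)" if "j < n" for j
    using le[OF that] nonneg_matsD(4)[OF A i that] Aux_D(1)[OF A Aux i that]
    by (cases "B $$ (i, j) = 0") auto
  then have "0 \<le> (\<Sum>j<n. A $$ (i, j)) * (m * v i - mat_app A v i)"
    unfolding Aux_row_identity[OF A Aux i] by (intro sum_nonneg) auto
  then show ?thesis using R by (simp add: zero_le_mult_iff)
qed

lemma Aux_mat_app_ge:
  assumes A: "A \<in> nonneg_mats n" and Aux: "Aux A = B" and i: "i < n"
    and ex: "\<exists>j<n. B $$ (i, j) \<noteq> 0"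
    and ge: "\<And>j. j < n \<Longrightarrow> B $$ (i, j) \<noteq> 0 \<Longrightarrow> m * v i \<le> B $$ (i, j) * v j"
  shows "m * v i \<le> mat_app A v i"
proof -
  have R: "0 < (\<Sum>j<n. A $$ (i, j))"
  proof -
    obtain j where j: "j < n" "B $$ (i, j) \<noteq> 0" using ex by blast
    show ?thesis
      by (rule sum_pos2[of _ j])
        (use j nonneg_matsD[OF A] Aux_D(1)[OF A Aux i j(1)] i in \<open>auto simp: order_less_le\<close>)
  qed
  have "A $$ (i, j) * (m * v i - B $$ (i, j) * v j) \<le> 0" if "j < n" for j
    using ge[OF that] nonneg_matsD(4)[OF A i that] Aux_D(1)[OF A Aux i that]
    by (cases "B $$ (i, j) = 0") (auto simp: mult_le_0_iff)
  then have "(\<Sum>j<n. A $$ (i, j)) * (m * v i - mat_app A v i) \<le> 0"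
    unfolding Aux_row_identity[OF A Aux i] by (intro sum_nonpos) auto
  then show ?thesis using R by (simp add: mult_le_0_iff)
qed

text \<open>The arc defects have one sign and their weighted sum is 0, so they vanish on the
  support. The factor \<open>s\<close> serves the upper and the lower estimate at once.\<close>

lemma Aux_mat_app_eq:
  assumes A: "A \<in> nonneg_mats n" and Aux: "Aux A = B" and i: "i < n"
    and eq: "mat_app A v i = m * v i"
    and sgn: "s = 1 \<or> s = (- 1 :: real)"
    and le: "\<And>j. j < n \<Longrightarrow> B $$ (i, j) \<noteq> 0 \<Longrightarrow> 0 \<le> s * (m * v i - B $$ (i, j) * v j)"
    and j: "j < n" "B $$ (i, j) \<noteq> 0"
  shows "B $$ (i, j) * v j = m * v i"
proof -
  have nn: "0 \<le> A $$ (i, j) * (s * (m * v i - B $$ (i, j) * v j))" if "j < n" for j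
    using le[OF that] nonneg_matsD(4)[OF A i that] Aux_D(1)[OF A Aux i that]
    by (cases "B $$ (i, j) = 0") auto
  have "(\<Sum>j<n. A $$ (i, j) * (s * (m * v i - B $$ (i, j) * v j)))
      = s * (\<Sum>j<n. A $$ (i, j) * (m * v i - B $$ (i, j) * v j))"
    by (simp add: sum_distrib_left mult_ac)
  also have "\<dots> = 0"
    using Aux_row_identity[OF A Aux i, of m v] eq by simp
  finally have "A $$ (i, j) * (s * (m * v i - B $$ (i, j) * v j)) = 0"
    using nn j(1) by (subst (asm) sum_nonneg_eq_0_iff) auto
  then show ?thesis using Aux_D(1)[OF A Aux i j(1)] j(2) sgn by auto
qed

section \<open>The set of Perron roots\<close>

lemma eta_nonempty:
  assumes B: "B \<in> nonneg_mats n" and "row_uniform B"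
  obtains A where "A \<in> nonneg_mats n" "Aux A = B"
proof -
  note Bn = nonneg_matsD[OF B]
  define S where "S i = {k. k < n \<and> B $$ (i, k) \<noteq> 0}" for i
  \<comment> \<open>The weight of a row is spread evenly over its support. A zero row yields
    \<open>0 / 0\<close>, which is 0.\<close>
  define A where "A = mat n n (\<lambda>(i, j). B $$ (i, j) / card (S i))"
  have fin: "finite (S i)" for i by (simp add: S_def)
  have A: "A \<in> nonneg_mats n" using Bn by (auto simp: A_def nonneg_mats_def)
  moreover have "Aux A = B"
  proof (rule Aux_eqI[OF A B])
    fix i j assume ij: "i < n" "j < n"
    show "A $$ (i, j) \<noteq> 0 \<longleftrightarrow> B $$ (i, j) \<noteq> 0"
      using ij fin[of i] by (auto simp: A_def S_def)
    assume b: "B $$ (i, j) \<noteq> 0"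
    have "(\<Sum>k<n. A $$ (i, k)) = (\<Sum>k\<in>S i. B $$ (i, k) / card (S i))"
      using ij by (intro sum.mono_neutral_cong_right) (auto simp: A_def S_def)
    also have "\<dots> = (\<Sum>k\<in>S i. B $$ (i, j) / card (S i))"
      using ij b Bn \<open>row_uniform B\<close> unfolding row_uniform_def
      by (intro sum.cong arg_cong2[of _ _ _ _ "(/)"]) (auto simp: S_def)
    also have "\<dots> = B $$ (i, j)"
      using ij b fin[of i] by (auto simp: S_def)
    finally show "(\<Sum>k<n. A $$ (i, k)) = B $$ (i, j)" .
  qed
  ultimately show thesis using that by blast
qed

text \<open>The entries of \<open>A t\<close> interpolate between two degenerate matrices, each having a single entry
  per row, at \<open>t = 0\<close> and \<open>t = 1\<close>, with respective spectral radii below and above \<open>r\<close>. The values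
  of \<open>t\<close> for which the spectral radius is less than, respectively greater than \<open>r\<close> are
  characterized by strict inequalities with a positive vector, hence they form two disjoint open
  sets, which cannot cover \<open>[0, 1]\<close>.\<close>

lemma rho_intermediate:
  assumes B: "B \<in> nonneg_mats n" and irr: "irreducible_mat B" and ru: "row_uniform B"
    and v0: "\<And>i. i < n \<Longrightarrow> 0 < v0 i"
      "\<And>i. i < n \<Longrightarrow> \<exists>j<n. B $$ (i, j) \<noteq> 0 \<and> B $$ (i, j) * v0 j < r * v0 i"
    and v1: "\<And>i. i < n \<Longrightarrow> 0 < v1 i"
      "\<And>i. i < n \<Longrightarrow> \<exists>j<n. B $$ (i, j) \<noteq> 0 \<and> r * v1 i < B $$ (i, j) * v1 j"
  obtains A where "A \<in> nonneg_mats n" "Aux A = B" "rho A = r"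
proof -
  note Bn = nonneg_matsD[OF B]
  have n: "0 < n" using irreducible_mat_dim_pos[OF irr Bn(1)] .
  obtain f0 where f0: "\<And>i. i < n \<Longrightarrow> f0 i < n \<and> B $$ (i, f0 i) \<noteq> 0 \<and> B $$ (i, f0 i) * v0 (f0 i) < r * v0 i"
    using v0(2) by metis
  obtain f1 where f1: "\<And>i. i < n \<Longrightarrow> f1 i < n \<and> B $$ (i, f1 i) \<noteq> 0 \<and> r * v1 i < B $$ (i, f1 i) * v1 (f1 i)"
    using v1(2) by metis
  obtain U where U: "U \<in> nonneg_mats n" "Aux U = B"
    using eta_nonempty[OF B ru] .
  note Un = nonneg_matsD[OF U(1)]
  define F where "F f i j = (if j = f i then B $$ (i, j) else 0)" for f :: "nat \<Rightarrow> nat" and i j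
  \<comment> \<open>The coefficients are nonnegative on \<open>[0, 1]\<close> and sum to 1, which
    preserves the row sums; strictly inside, the multiple of \<open>U\<close> provides the full
    support of \<open>B\<close>.\<close>
  define A where "A t = mat n n (\<lambda>(i, j). (1 - t)\<^sup>2 * F f0 i j + t\<^sup>2 * F f1 i j
    + 2 * t * (1 - t) * U $$ (i, j))" for t :: real
  have F_nonneg: "0 \<le> F f i j" if "i < n" "j < n" for f i j
    using Bn that by (simp add: F_def)
  have F_sum: "(\<Sum>j<n. F f i j * v j) = B $$ (i, f i) * v (f i)" if "f i < n" for f i v
    using that by (simp add: F_def if_distrib[of "\<lambda>x. x * _"] cong: if_cong)
  have A_nonneg: "A t \<in> nonneg_mats n" if "0 \<le> t" "t \<le> 1" for t
    using that F_nonneg Un by (auto simp: A_def nonneg_mats_def)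
  have A_app: "mat_app (A t) v i = (\<Sum>j<n. ((1 - t)\<^sup>2 * F f0 i j + t\<^sup>2 * F f1 i j
    + 2 * t * (1 - t) * U $$ (i, j)) * v j)" if "i < n" for t v i
    using that by (simp add: mat_app_def A_def)
  have A_Aux: "Aux (A t) = B" if t: "0 < t" "t < 1" for t
  proof (rule Aux_eqI[OF A_nonneg B])
    fix i j assume ij: "i < n" "j < n"
    have Aij: "A t $$ (i, j) = (1 - t)\<^sup>2 * F f0 i j + t\<^sup>2 * F f1 i j + 2 * t * (1 - t) * U $$ (i, j)"
      using ij by (simp add: A_def)
    show "A t $$ (i, j) \<noteq> 0 \<longleftrightarrow> B $$ (i, j) \<noteq> 0"
    proof (cases "B $$ (i, j) = 0")
      case True
      have "F f i j = 0" for f unfolding F_def True by simp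
      then show ?thesis using True Aux_D(1)[OF U ij] unfolding Aij by simp
    next
      case False
      then have "0 < U $$ (i, j)"
        using Aux_D(1)[OF U ij] Un(4)[OF ij] by simp
      then have "0 < A t $$ (i, j)"
        unfolding Aij using t F_nonneg[OF ij] by (intro add_nonneg_pos add_nonneg_nonneg) auto
      then show ?thesis using False by simp
    qed
    assume b: "B $$ (i, j) \<noteq> 0"
    have Bf: "B $$ (i, f i) = B $$ (i, j)" if "f i < n" "B $$ (i, f i) \<noteq> 0" for f :: "nat \<Rightarrow> nat"
      using ru b ij Bn that unfolding row_uniform_def by metis
    have Fs: "(\<Sum>k<n. F f i k) = B $$ (i, j)" if "f i < n" "B $$ (i, f i) \<noteq> 0" for f
      using F_sum[of f i "\<lambda>_. 1"] Bf[of f] that by simp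
    have Us: "(\<Sum>k<n. U $$ (i, k)) = B $$ (i, j)"
      using Aux_D[OF U ij] b by simp
    have "(\<Sum>k<n. A t $$ (i, k)) = (1 - t)\<^sup>2 * (\<Sum>k<n. F f0 i k) + t\<^sup>2 * (\<Sum>k<n. F f1 i k)
        + 2 * t * (1 - t) * (\<Sum>k<n. U $$ (i, k))"
      using ij by (simp add: A_def sum.distrib sum_distrib_left)
    also have "\<dots> = (1 - t)\<^sup>2 * B $$ (i, j) + t\<^sup>2 * B $$ (i, j) + 2 * t * (1 - t) * B $$ (i, j)"
      using f0[OF ij(1)] f1[OF ij(1)] Fs[of f0] Fs[of f1] Us by presburger
    also have "\<dots> = B $$ (i, j)" by (simp add: power2_eq_square algebra_simps)
    finally show "(\<Sum>k<n. A t $$ (i, k)) = B $$ (i, j)" .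
  qed (use t in auto)
  define T0 where "T0 = (\<Union>v\<in>{v. \<forall>i<n. 0 < v i}. \<Inter>i\<in>{..<n}. {t. mat_app (A t) v i < r * v i})"
  define T1 where "T1 = (\<Union>v\<in>{v. \<forall>i<n. 0 < v i}. \<Inter>i\<in>{..<n}. {t. r * v i < mat_app (A t) v i})"
  have cont: "continuous_on UNIV (\<lambda>t. mat_app (A t) v i)" if "i < n" for v i
    unfolding A_app[OF that] by (intro continuous_intros)
  have open0: "open T0" unfolding T0_def
    by (intro open_UN ballI open_INT finite_lessThan open_Collect_less continuous_on_const cont) auto
  have open1: "open T1" unfolding T1_def
    by (intro open_UN ballI open_INT finite_lessThan open_Collect_less continuous_on_const cont) auto
  have zero: "0 \<in> T0"
    unfolding T0_def by (rule UN_I[of v0]) (use v0(1) f0 in \<open>auto simp: A_app F_sum\<close>)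
  have one: "1 \<in> T1"
    unfolding T1_def by (rule UN_I[of v1]) (use v1(1) f1 in \<open>auto simp: A_app F_sum\<close>)
  have less: "rho (A t) < r" if "t \<in> T0" "t \<in> {0..1}" for t
    using that rho_less[OF A_nonneg n, of t] by (auto simp: T0_def)
  have greater: "r < rho (A t)" if "t \<in> T1" "t \<in> {0..1}" for t
  proof -
    obtain v where v: "\<And>i. i < n \<Longrightarrow> 0 < v i" "\<And>i. i < n \<Longrightarrow> r * v i < mat_app (A t) v i"
      using \<open>t \<in> T1\<close> by (auto simp: T1_def)
    have "v 0 \<noteq> 0" using v(1)[OF n] by simp
    then show ?thesis
      by (intro rho_greater[OF A_nonneg n, of t v 0]) (use v that(2) n in \<open>auto simp: less_imp_le\<close>)
  qed
  \<comment> \<open>\<open>A t\<close> is known to be nonnegative only on the unit interval, so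
    disjointness is claimed only there.\<close>
  have disj: "T0 \<inter> T1 \<inter> {0..1} = {}"
    using less greater by (meson IntE order.asym equals0I)
  have "0 \<in> T0 \<inter> {0..1}" "1 \<in> T1 \<inter> {0..1}"
    using zero one by auto
  then have "\<not> {0..1} \<subseteq> T0 \<union> T1"
    using connectedD[OF connected_Icc[of 0 "1 :: real"] open0 open1 disj] by blast
  then obtain t where t: "t \<in> {0..1}" "t \<notin> T0" "t \<notin> T1" by blast
  have t01: "0 < t" "t < 1"
    using t zero one by (auto simp: order_less_le)
  have An: "A t \<in> nonneg_mats n" using A_nonneg t by simp
  note Aux = A_Aux[OF t01]
  \<comment> \<open>If the spectral radius differed from \<open>r\<close>, the Perron vector would
    witness membership of \<open>t\<close> in \<open>T0\<close> or \<open>T1\<close>.\<close>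
  obtain v where v: "\<And>i. i < n \<Longrightarrow> 0 < v i" "\<And>i. i < n \<Longrightarrow> mat_app (A t) v i = rho (A t) * v i"
    using perron_eigenvector[OF An Aux_irreducible[OF An Aux irr]] by blast
  have "\<not> rho (A t) < r"
  proof
    assume "rho (A t) < r"
    then have "\<forall>i<n. mat_app (A t) v i < r * v i" using v by simp
    then show False using t(2) v(1) by (auto simp: T0_def)
  qed
  moreover have "\<not> r < rho (A t)"
  proof
    assume "r < rho (A t)"
    then have "\<forall>i<n. r * v i < mat_app (A t) v i" using v by simp
    then show False using t(3) v(1) by (auto simp: T1_def)
  qed
  ultimately show thesis using that[OF An Aux] by simp
qed

section \<open>Bounds on the Perron roots by cycle means\<close>

text \<open>Without cycles every positive \<open>m\<close> admits a potential, so
  \<open>rho A\<close> is at most every positive number.\<close>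

lemma rho_eq_0_if_acyclic:
  assumes B: "B \<in> nonneg_mats n" and "0 < n" and empty: "cycle_means B = {}"
    and A: "A \<in> nonneg_mats n" "Aux A = B"
  shows "rho A = 0"
proof -
  have "rho A \<le> 0 + m" if m: "0 < m" for m
  proof -
    have "\<not> mat_cycle B p" for p using empty by (auto simp: cycle_means_def)
    then obtain v where v: "\<And>i. i < n \<Longrightarrow> 0 < v i"
      "\<And>i j. i < n \<Longrightarrow> j < n \<Longrightarrow> B $$ (i, j) \<noteq> 0 \<Longrightarrow> B $$ (i, j) * v j \<le> m * v i"
      using potential_upper[OF B m] by metis
    have "mat_app A v i \<le> m * v i" if "i < n" for i
      using v that m by (intro Aux_mat_app_le[OF A that]) (auto simp: less_imp_le)
    then show ?thesis using rho_le[OF A(1) \<open>0 < n\<close>, of v m] v(1) by simp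
  qed
  then have "rho A \<le> 0" by (rule field_le_epsilon)
  then show ?thesis using rho_nonneg[OF A(1) \<open>0 < n\<close>] by simp
qed

lemma rho_le_mu:
  assumes B: "B \<in> nonneg_mats n" and irr: "irreducible_mat B" and ne: "cycle_means B \<noteq> {}"
    and A: "A \<in> nonneg_mats n" "Aux A = B"
  shows "rho A \<le> mu B" and "nu B < mu B \<Longrightarrow> rho A < mu B"
proof -
  have n: "0 < n" using irreducible_mat_dim_pos[OF irr nonneg_matsD(1)[OF B]] .
  have m: "0 < mu B" using mu_attained[OF B ne] by metis
  obtain v where v: "\<And>i. i < n \<Longrightarrow> 0 < v i"
    "\<And>i j. i < n \<Longrightarrow> j < n \<Longrightarrow> B $$ (i, j) \<noteq> 0 \<Longrightarrow> B $$ (i, j) * v j \<le> mu B * v i"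
    using potential_upper[OF B m arc_prod_le_mu[OF B]] by blast
  have le: "mat_app A v i \<le> mu B * v i" if "i < n" for i
    using v that m by (intro Aux_mat_app_le[OF A that]) (auto simp: less_imp_le)
  then show "rho A \<le> mu B" using rho_le[OF A(1) n, of v] v(1) by blast
  assume lt: "nu B < mu B"
  show "rho A < mu B"
  proof (rule ccontr)
    assume contr: "\<not> rho A < mu B"
    \<comment> \<open>By irreducibility a strict row would already give
      \<open>rho A < mu B\<close>.\<close>
    have eq: "mat_app A v i = mu B * v i" if "i < n" for i
      using rho_less_irreducible[OF A(1) Aux_irreducible[OF A irr], of v "mu B" i] v(1) le that contr
      by (meson order_le_less)
    \<comment> \<open>Equality on all arcs would give every cycle the mean \<open>mu B\<close>,
      which a cycle of minimal mean contradicts.\<close>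
    obtain p where p: "mat_cycle B p" "arc_prod B p = nu B ^ length p" and nu: "0 < nu B"
      using nu_attained[OF B ne] .
    have "B $$ (i, j) * v j = mu B * v i" if "i < n" "j < n" "B $$ (i, j) \<noteq> 0" for i j
      by (rule Aux_mat_app_eq[OF A that(1) eq[OF that(1)], of 1]) (use that v(2) in auto)
    then have "cycle_mean B p = mu B"
      using cycle_mean_eqI[OF B p(1), of v "mu B"] v(1) m by blast
    moreover have "cycle_mean B p = nu B"
      using p nu mat_cycleD(1)[OF nonneg_matsD(1)[OF B] p(1)]
      by (simp add: cycle_mean_def real_root_power_cancel)
    ultimately show False using lt by simp
  qed
qed

text \<open>Dual to the bound by \<open>mu B\<close>, with a lower potential and, for the
  contradiction, a cycle of maximal mean; the sign \<open>-1\<close> accounts for the reversed arc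
  inequalities.\<close>

lemma rho_ge_nu:
  assumes B: "B \<in> nonneg_mats n" and irr: "irreducible_mat B" and ne: "cycle_means B \<noteq> {}"
    and A: "A \<in> nonneg_mats n" "Aux A = B"
  shows "nu B \<le> rho A" and "nu B < mu B \<Longrightarrow> nu B < rho A"
proof -
  have n: "0 < n" using irreducible_mat_dim_pos[OF irr nonneg_matsD(1)[OF B]] .
  have m: "0 < nu B" using nu_attained[OF B ne] by metis
  obtain v where v: "\<And>i. i < n \<Longrightarrow> 0 < v i"
    "\<And>i j. i < n \<Longrightarrow> j < n \<Longrightarrow> B $$ (i, j) \<noteq> 0 \<Longrightarrow> nu B * v i \<le> B $$ (i, j) * v j"
    using potential_lower[OF B m arc_prod_ge_nu[OF B]] by blast
  have v0: "0 \<le> v i" if "i < n" for i using v(1)[OF that] by simp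
  have v00: "v 0 \<noteq> 0" using v(1)[OF n] by simp
  have ge: "nu B * v i \<le> mat_app A v i" if "i < n" for i
    using v that by (intro Aux_mat_app_ge[OF A that exists_arc_in_row[OF B irr ne that]]) auto
  then show "nu B \<le> rho A" using rho_ge[OF A(1), of v 0] v0 v00 n by blast
  assume lt: "nu B < mu B"
  show "nu B < rho A"
  proof (rule ccontr)
    assume contr: "\<not> nu B < rho A"
    have eq: "mat_app A v i = nu B * v i" if "i < n" for i
      using rho_greater_irreducible[OF A(1) Aux_irreducible[OF A irr], of v 0 "nu B" i] v0 v00 n ge that contr
      by (metis order_le_less)
    obtain p where p: "mat_cycle B p" "arc_prod B p = mu B ^ length p" and mu: "0 < mu B"
      using mu_attained[OF B ne] .
    have "B $$ (i, j) * v j = nu B * v i" if "i < n" "j < n" "B $$ (i, j) \<noteq> 0" for i j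
      by (rule Aux_mat_app_eq[OF A that(1) eq[OF that(1)], of "-1"]) (use that v(2) in auto)
    then have "cycle_mean B p = nu B"
      using cycle_mean_eqI[OF B p(1), of v "nu B"] v(1) m by blast
    moreover have "cycle_mean B p = mu B"
      using p mu mat_cycleD(1)[OF nonneg_matsD(1)[OF B] p(1)]
      by (simp add: cycle_mean_def real_root_power_cancel)
    ultimately show False using lt by simp
  qed
qed

theorem corollary3p8:
  fixes n :: nat and B :: "real mat"
  assumes "B \<in> nonneg_mats n"
    and "irreducible_mat B"
    and "row_uniform B"
  shows "(nu B < mu B \<longrightarrow> eta B = {nu B<..<mu B}) \<and>
         (nu B = mu B \<longrightarrow> {nu B} = eta B \<and> eta B = {mu B})"
proof -
  note Bn = nonneg_matsD[OF assms(1)]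
  have n: "0 < n" using irreducible_mat_dim_pos[OF assms(2) Bn(1)] .
  obtain U where U: "U \<in> nonneg_mats n" "Aux U = B"
    using eta_nonempty[OF assms(1,3)] .
  have eta: "eta B = {rho A |A. A \<in> nonneg_mats n \<and> Aux A = B}"
    using Bn by (simp add: eta_def)
  have eta_singleton: "eta B = {c}" if "\<And>A. A \<in> nonneg_mats n \<Longrightarrow> Aux A = B \<Longrightarrow> rho A = c" for c
  proof -
    have "rho U \<in> eta B" using U unfolding eta by blast
    moreover have "x = c" if "x \<in> eta B" for x
      using that \<open>\<And>A. A \<in> nonneg_mats n \<Longrightarrow> Aux A = B \<Longrightarrow> rho A = c\<close> unfolding eta by blast
    ultimately show ?thesis by blast
  qed
  show ?thesis
  proof (cases "cycle_means B = {}")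
    case True
    \<comment> \<open>Both \<open>nu B\<close> and \<open>mu B\<close> take the default value 0
      here.\<close>
    have "eta B = {0}"
      by (rule eta_singleton) (rule rho_eq_0_if_acyclic[OF assms(1) n True])
    then show ?thesis using True by (simp add: mu_def nu_def)
  next
    case False
    note le = rho_le_mu[OF assms(1,2) False] and ge = rho_ge_nu[OF assms(1,2) False]
    have "eta B = {nu B<..<mu B}" if lt: "nu B < mu B"
    proof
      show "eta B \<subseteq> {nu B<..<mu B}" using le(2) ge(2) lt unfolding eta by auto
      show "{nu B<..<mu B} \<subseteq> eta B"
      proof
        fix r assume r: "r \<in> {nu B<..<mu B}"
        have "0 < nu B" using nu_attained[OF assms(1) False] by metis
        then have r0: "0 < r" "nu B < r" "r < mu B" using r by auto
        \<comment> \<open>The vectors \<open>v0\<close> and \<open>v1\<close> certify a choice of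
          one arc per row with spectral radius below, respectively above \<open>r\<close>.\<close>
        obtain v0 where v0: "\<And>i. i < n \<Longrightarrow> 0 < v0 i"
            "\<And>i. i < n \<Longrightarrow> \<exists>j<n. B $$ (i, j) \<noteq> 0 \<and> B $$ (i, j) * v0 j < r * v0 i"
          using growth_lower[OF assms(1,2) False r0(2)] by blast
        obtain v1 where v1: "\<And>i. i < n \<Longrightarrow> 0 < v1 i"
            "\<And>i. i < n \<Longrightarrow> \<exists>j<n. B $$ (i, j) \<noteq> 0 \<and> r * v1 i < B $$ (i, j) * v1 j"
          using growth_upper[OF assms(1,2) False r0(1,3)] by blast
        obtain A where "A \<in> nonneg_mats n" "Aux A = B" "rho A = r"
          by (rule rho_intermediate[OF assms, of v0 r v1]) (use v0 v1 in auto)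
        then show "r \<in> eta B" unfolding eta by blast
      qed
    qed
    moreover have "eta B = {mu B}" if "nu B = mu B"
      by (rule eta_singleton) (use le(1) ge(1) that in \<open>force intro: antisym\<close>)
    ultimately show ?thesis by auto
  qed
qed

end
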